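(* Let $\mu$ be a strict partition. Then for every integer $n\ge0$, $$\sum_{|\lambda/\mu|=n}\frac{2^{|\lambda|-\ell(\lambda)-|\mu|+\ell(\mu)}f_{\lambda/\mu}H_\mu}{H_\lambda}\Bigl(\sum_{\square\in\lambda}\binom{c_\square+1}{4}-\sum_{\square\in\mu}\binom{c_\square+1}{4}\Bigr)=\frac23\binom{n}{3}+\frac23|\mu|\binom{n}{2}+\frac1{12}\bigl(q_2(\mu)+|\mu|^2-2|\mu|\bigr)n,$$ where the sum ranges over strict partitions $\lambda\supseteq\mu$ with $|\lambda|-|\mu|=n$.
   Context: A strict partition is a finite strictly decreasing sequence of positive integers $\lambda=(\lambda_1>\cdots>\lambda_\ell)$ (the empty sequence is allowed); $|\lambda|=\sum_i\lambda_i$, $\ell(\lambda)=\ell$, and $\lambda_i=0$ for $i>\ell(\lambda)$. The (shifted Young) diagram of $\lambda$ is the set of boxes $(i,j)$ with $1\le i\le\ell(\lambda)$, $i+1\le j\le i+\lambda_i$ (row $i$, column $j$); $\lambda$ is identified with its diagram. The content of $\square=(i,j)$ is $c_\square=j-i$. The hook length $h_\square$ of $\square=(i,j)\in\lambda$ is the number of boxes of $\lambda$ in row $i$ strictly to the right of $\square$, plus the number of boxes $(i',j)\in\lambda$ with $i'>i$, plus $1$, plus $\lambda_j$; $H_\lambda=\prod_{\square\in\lambda}h_\square$ ($H_\emptyset=1$). Write $\lambda\supseteq\mu$ if $\lambda_i\ge\mu_i$ for all $i$; $\lambda/\mu$ is the set of boxes of $\lambda$ not in $\mu$, $|\lambda/\mu|=|\lambda|-|\mu|$.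 $f_{\lambda/\mu}$ is the number of standard shifted Young tableaux of shape $\lambda/\mu$ (bijective fillings of the boxes of $\lambda/\mu$ with $1,\dots,|\lambda/\mu|$ increasing along rows left to right and columns top to bottom; $f_{\mu/\mu}=1$). For a strict partition $\mu$: an outer corner is a box of $\mu$ whose removal leaves the diagram of a strict partition; let $(\alpha_1,\beta_1),\dots,(\alpha_m,\beta_m)$ be the outer corners with $\alpha_1>\cdots>\alpha_m$, $y_j=\beta_j-\alpha_j$; set $\alpha_{m+1}=0$, $\beta_0=\ell(\mu)+1$, $x_i=\beta_i-\alpha_{i+1}$ ($0\le i\le m$); and $q_2(\mu)=\sum_{i=0}^m\binom{x_i}{2}^2-\sum_{i=1}^m\binom{y_i}{2}^2$. *)

theory Defs
  imports Complex_Main "HOL-Library.Product_Lexorder"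
begin

definition strict_partition :: "nat list \<Rightarrow> bool" where
  "strict_partition lam \<longleftrightarrow> sorted_wrt (>) lam \<and> (\<forall>x\<in>set lam. 0 < x)"

definition part :: "nat list \<Rightarrow> nat \<Rightarrow> nat" where
  "part lam i = (if 1 \<le> i \<and> i \<le> length lam then lam ! (i - 1) else 0)"

definition psize :: "nat list \<Rightarrow> nat" where
  "psize lam = sum_list lam"

definition shifted_diagram :: "nat list \<Rightarrow> (nat \<times> nat) set" where
  "shifted_diagram lam =
     {(i, j). 1 \<le> i \<and> i \<le> length lam \<and> i + 1 \<le> j \<and> j \<le> i + part lam i}"

definition content :: "nat \<times> nat \<Rightarrow> int" where
  "content b = int (snd b) - int (fst b)"

definition hook :: "nat list \<Rightarrow> nat \<times> nat \<Rightarrow> nat" where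
  "hook lam b = (case b of (i, j) \<Rightarrow>
      card {j'. (i, j') \<in> shifted_diagram lam \<and> j' > j}
    + card {i'. (i', j) \<in> shifted_diagram lam \<and> i' > i}
    + 1 + part lam j)"

definition hook_product :: "nat list \<Rightarrow> nat" where
  "hook_product lam = (\<Prod>b\<in>shifted_diagram lam. hook lam b)"

definition contains :: "nat list \<Rightarrow> nat list \<Rightarrow> bool" where
  "contains lam mu \<longleftrightarrow> (\<forall>i. part mu i \<le> part lam i)"

definition skew :: "nat list \<Rightarrow> nat list \<Rightarrow> (nat \<times> nat) set" where
  "skew lam mu = shifted_diagram lam - shifted_diagram mu"

text \<open>Standard shifted Young tableaux of skew shape lam/mu: bijections onto
  {1..|lam/mu|}, increasing along rows (left to right) and down columns.
  Values outside the shape are fixed to 0 so the set is finite.\<close>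
definition num_syt :: "nat list \<Rightarrow> nat list \<Rightarrow> nat" where
  "num_syt lam mu = card {T :: nat \<times> nat \<Rightarrow> nat.
      bij_betw T (skew lam mu) {1..card (skew lam mu)}
    \<and> (\<forall>b. b \<notin> skew lam mu \<longrightarrow> T b = 0)
    \<and> (\<forall>i j j'. (i, j) \<in> skew lam mu \<longrightarrow> (i, j') \<in> skew lam mu \<longrightarrow> j < j' \<longrightarrow> T (i, j) < T (i, j'))
    \<and> (\<forall>i i' j. (i, j) \<in> skew lam mu \<longrightarrow> (i', j) \<in> skew lam mu \<longrightarrow> i < i' \<longrightarrow> T (i, j) < T (i', j))}"

definition outer_corners :: "nat list \<Rightarrow> (nat \<times> nat) set" where
  "outer_corners mu = {b \<in> shifted_diagram mu.
      \<exists>nu. strict_partition nu \<and> shifted_diagram nu = shifted_diagram mu - {b}}"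

text \<open>Corners listed with strictly decreasing row index alpha_1 > ... > alpha_m
  (corners lie in distinct rows, so lexicographic order is by rows).\<close>
definition corner_list :: "nat list \<Rightarrow> (nat \<times> nat) list" where
  "corner_list mu = rev (sorted_list_of_set (outer_corners mu))"

definition corner_alpha :: "nat list \<Rightarrow> nat \<Rightarrow> nat" where
  "corner_alpha mu k = (if 1 \<le> k \<and> k \<le> length (corner_list mu)
      then fst (corner_list mu ! (k - 1)) else 0)"

definition corner_beta :: "nat list \<Rightarrow> nat \<Rightarrow> nat" where
  "corner_beta mu k = (if k = 0 then length mu + 1
      else snd (corner_list mu ! (k - 1)))"

definition corner_x :: "nat list \<Rightarrow> nat \<Rightarrow> int" where
  "corner_x mu i = int (corner_beta mu i) - int (corner_alpha mu (i + 1))"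

definition corner_y :: "nat list \<Rightarrow> nat \<Rightarrow> int" where
  "corner_y mu j = int (corner_beta mu j) - int (corner_alpha mu j)"

definition binom2 :: "int \<Rightarrow> int" where
  "binom2 x = x * (x - 1) div 2"

definition q2 :: "nat list \<Rightarrow> int" where
  "q2 mu = (let m = length (corner_list mu) in
      (\<Sum>i=0..m. (binom2 (corner_x mu i))^2) - (\<Sum>j=1..m. (binom2 (corner_y mu j))^2))"

text \<open>binom(c+1, 4) for a box content c (c >= 1 inside a shifted diagram).\<close>
definition content_binom4 :: "nat \<times> nat \<Rightarrow> real" where
  "content_binom4 b = real (nat (content b + 1) choose 4)"

end

theory Submission
  imports Defs
begin

text \<open>
  Identify a strict partition with the finite set $A$ of its parts and put
  $X_a = a(a+1)/2$, $Y_a = a(a-1)/2$. With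
  $H = \prod_a a! \prod_{a > b} (a+b)/(a-b)$, the quotient of the values of
  $2^{|\lambda|-\ell(\lambda)}/H_\lambda$ before and after enlarging a part
  $a \in A \cup \{0\}$ to $a + 1$ becomes
  $p_a = \prod_{b \in A} (X_a - Y_b) / \prod_{b \in A \cup \{0\}, b \neq a} (X_a - X_b)$,
  the residue at $X_a$ of $\prod_{b \in A} (z - Y_b) / \prod_{b \in A \cup \{0\}} (z - X_b)$;
  it vanishes when the box cannot be added. Expanding at infinity gives
  $\sum p_a = 1$, $\sum p_a X_a = |\lambda|$ and
  $\sum p_a X_a^2 = (|\lambda|^2 + \sum_{a \in A} a^3)/2$, and telescoping over runs of
  consecutive parts shows $q_2 = \sum_{a \in A} a^3$. A new box of content $a + 1$ contributes
  $X_a (X_a - 1)/6$ to the content sum and $6 X_a + 1$ to $q_2$, so removing the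
  largest entry of a tableau turns the claim into an induction on $n$.
\<close>

text \<open>No residue theorem or limit at infinity is used. The moments come from induction on the
  set of poles: a new pole turns a weighted sum over the enlarged set into a weighted sum of divided
  differences over the old one, and for 1, X, X^2 these are polynomials again.

  The index 0 stands for an empty row. It supplies one more pole than there are zeros, so the
  rational function behaves like 1/z and the weights sum to 1. They can therefore be read as
  transition probabilities of a process that adds one box at a time. The power of 2 is what makes
  this normalisation exact: enlarging an existing part doubles 2^(|lambda| - l), creating a part
  does not, and the pole at X_0 = 0 accounts for the difference.

  The induction on n closes because averaging over one new box preserves a small space: the
  increment of the content sum involves only the sum of cubes and the size, that of the sum of cubes
  only the size, and the size is constant on each level. This triangular structure gives a
  polynomial of degree 3 in n.\<close>

section \<open>Moments of residue weights\<close>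

text \<open>The distinguished index \<open>e\<close> has a pole \<open>X e\<close> but no zero; it
  will be the part 0.\<close>

definition residue_weight :: "('a \<Rightarrow> real) \<Rightarrow> ('a \<Rightarrow> real) \<Rightarrow> 'a \<Rightarrow> 'a set \<Rightarrow> 'a \<Rightarrow> real" where
  "residue_weight X Y e A i = (\<Prod>j\<in>A. X i - Y j) / (\<Prod>j\<in>insert e A - {i}. X i - X j)"

lemma residue_weight_insert_old:
  assumes "finite A" "c \<notin> insert e A" "i \<in> insert e A"
  shows "residue_weight X Y e (insert c A) i
    = residue_weight X Y e A i * ((X i - Y c) / (X i - X c))"
proof -
  have "insert e (insert c A) - {i} = insert c (insert e A - {i})"
    using assms by auto
  then show ?thesis
    using assms by (simp add: residue_weight_def mult_ac)
qed

lemma residue_weight_insert_new: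
  assumes "finite A" "c \<notin> insert e A"
  shows "residue_weight X Y e (insert c A) c
    = (X c - Y c) * ((\<Prod>j\<in>A. X c - Y j) / (\<Prod>j\<in>insert e A. X c - X j))"
proof -
  have "insert e (insert c A) - {c} = insert e A"
    using assms by auto
  then show ?thesis
    using assms by (simp add: residue_weight_def)
qed

text \<open>The weight at the new pole is \<open>X c - Y c\<close> times the old rational function
  evaluated at \<open>X c\<close>, and \<open>pf\<close> expands that value in the old weights.
  Collecting terms leaves the divided difference of (z - Y c) f(z) at \<open>X i\<close> and
  \<open>X c\<close>.\<close>

lemma sum_residue_weight_insert:
  assumes fin: "finite A" and c: "c \<notin> insert e A" and inj: "inj_on X (insert e (insert c A))"
    and pf: "(\<Sum>i\<in>insert e A. residue_weight X Y e A i / (X c - X i))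
      = (\<Prod>j\<in>A. X c - Y j) / (\<Prod>j\<in>insert e A. X c - X j)"
  shows "(\<Sum>i\<in>insert e (insert c A). residue_weight X Y e (insert c A) i * f i)
    = (\<Sum>i\<in>insert e A. residue_weight X Y e A i *
         (((X i - Y c) * f i - (X c - Y c) * f c) / (X i - X c)))"
proof -
  have ne: "X i - X c \<noteq> 0" if "i \<in> insert e A" for i
    using inj_onD[OF inj, of i c] that c by auto
  have "(\<Sum>i\<in>insert e (insert c A). residue_weight X Y e (insert c A) i * f i)
      = residue_weight X Y e (insert c A) c * f c
        + (\<Sum>i\<in>insert e A. residue_weight X Y e (insert c A) i * f i)"
    using fin c by (subst insert_commute, subst sum.insert) auto
  also have "(\<Sum>i\<in>insert e A. residue_weight X Y e (insert c A) i * f i)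
      = (\<Sum>i\<in>insert e A. residue_weight X Y e A i * ((X i - Y c) / (X i - X c)) * f i)"
    by (rule sum.cong) (simp_all only: residue_weight_insert_old[OF fin c])
  also have "residue_weight X Y e (insert c A) c * f c
      = (\<Sum>i\<in>insert e A. (X c - Y c) * (residue_weight X Y e A i / (X c - X i)) * f c)"
    by (simp only: residue_weight_insert_new[OF fin c] pf[symmetric] sum_distrib_left sum_distrib_right)
  also have "\<dots> + (\<Sum>i\<in>insert e A. residue_weight X Y e A i * ((X i - Y c) / (X i - X c)) * f i)
      = (\<Sum>i\<in>insert e A. residue_weight X Y e A i *
         (((X i - Y c) * f i - (X c - Y c) * f c) / (X i - X c)))"
    unfolding sum.distrib[symmetric]
  proof (rule sum.cong)
    fix i assume i: "i \<in> insert e A"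
    have "X c - X i = - (X i - X c)" by simp
    then show "(X c - Y c) * (residue_weight X Y e A i / (X c - X i)) * f c +
          residue_weight X Y e A i * ((X i - Y c) / (X i - X c)) * f i =
          residue_weight X Y e A i * (((X i - Y c) * f i - (X c - Y c) * f c) / (X i - X c))"
      using ne[OF i] by (simp add: divide_simps) (simp add: algebra_simps)
  qed simp
  finally show ?thesis .
qed

text \<open>For f = 1/(z - X) the divided difference factors, and the new factor (z - Y c)/(z - X c)
  leaves the sum. The point z stays arbitrary because the induction hypothesis is used both at z and
  at \<open>X c\<close>.\<close>

lemma residue_weight_partial_fractions:
  assumes "finite A" "e \<notin> A" "inj_on X (insert e A)" "z \<notin> X ` insert e A"
  shows "(\<Sum>i\<in>insert e A. residue_weight X Y e A i / (z - X i))
      = (\<Prod>j\<in>A. z - Y j) / (\<Prod>j\<in>insert e A. z - X j)"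
  using assms
proof (induction A arbitrary: z rule: finite_induct)
  case empty
  then show ?case by (simp add: residue_weight_def)
next
  case (insert c A)
  have c: "c \<notin> insert e A" and eA: "e \<notin> A" using insert by auto
  have inj: "inj_on X (insert e A)" using insert.prems(2) by (rule inj_on_subset) auto
  have Xc: "X c \<notin> X ` insert e A" using insert.prems(2) c by (auto simp: inj_on_def)
  have z: "z \<notin> X ` insert e A" and zc: "z \<noteq> X c" using insert.prems(3) by auto
  note pf = insert.IH[OF eA inj]
  have "(\<Sum>i\<in>insert e (insert c A). residue_weight X Y e (insert c A) i / (z - X i))
      = (\<Sum>i\<in>insert e A. residue_weight X Y e A i *
         (((X i - Y c) * (1 / (z - X i)) - (X c - Y c) * (1 / (z - X c))) / (X i - X c)))"
    using sum_residue_weight_insert[OF insert.hyps(1) c insert.prems(2) pf[OF Xc], of "\<lambda>i. 1 / (z - X i)"]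
    by simp
  also have "\<dots> = (\<Sum>i\<in>insert e A. residue_weight X Y e A i / (z - X i) * ((z - Y c) / (z - X c)))"
  proof (rule sum.cong)
    fix i assume "i \<in> insert e A"
    then have "X i - X c \<noteq> 0" "z - X i \<noteq> 0" "z - X c \<noteq> 0" using Xc z zc by (metis image_eqI right_minus_eq)+
    then have "((X i - Y c) * (1 / (z - X i)) - (X c - Y c) * (1 / (z - X c))) / (X i - X c)
        = 1 / (z - X i) * ((z - Y c) / (z - X c))"
      by (simp add: divide_simps) (simp add: algebra_simps)
    then show "residue_weight X Y e A i *
         (((X i - Y c) * (1 / (z - X i)) - (X c - Y c) * (1 / (z - X c))) / (X i - X c))
       = residue_weight X Y e A i / (z - X i) * ((z - Y c) / (z - X c))" by simp
  qed simp
  also have "\<dots> = (\<Prod>j\<in>A. z - Y j) / (\<Prod>j\<in>insert e A. z - X j) * ((z - Y c) / (z - X c))"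
    by (simp only: sum_distrib_right[symmetric] pf[OF z])
  also have "\<dots> = (\<Prod>j\<in>insert c A. z - Y j) / (\<Prod>j\<in>insert e (insert c A). z - X j)"
    using insert.hyps c by (subst insert_commute[of e c]) (simp add: mult_ac)
  finally show ?case .
qed

text \<open>The divided differences for 1, X and X^2 are polynomials in \<open>X i\<close>, so each
  moment of the enlarged set is a combination of moments of the old one. The choice
  \<open>X e = 0\<close> keeps the unmatched pole out of the power sums.\<close>

lemma residue_weight_moments:
  assumes "finite A" "e \<notin> A" "inj_on X (insert e A)" "X e = 0"
  shows "(\<Sum>i\<in>insert e A. residue_weight X Y e A i) = 1"
    and "(\<Sum>i\<in>insert e A. residue_weight X Y e A i * X i) = (\<Sum>j\<in>A. X j - Y j)"
    and "(\<Sum>i\<in>insert e A. residue_weight X Y e A i * (X i)\<^sup>2)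
      = ((\<Sum>j\<in>A. X j - Y j)\<^sup>2 + (\<Sum>j\<in>A. (X j)\<^sup>2 - (Y j)\<^sup>2)) / 2"
proof -
  have "(\<Sum>i\<in>insert e A. residue_weight X Y e A i) = 1 \<and>
    (\<Sum>i\<in>insert e A. residue_weight X Y e A i * X i) = (\<Sum>j\<in>A. X j - Y j) \<and>
    (\<Sum>i\<in>insert e A. residue_weight X Y e A i * (X i)\<^sup>2)
      = ((\<Sum>j\<in>A. X j - Y j)\<^sup>2 + (\<Sum>j\<in>A. (X j)\<^sup>2 - (Y j)\<^sup>2)) / 2"
    using assms
  proof (induction A rule: finite_induct)
    case empty
    then show ?case by (simp add: residue_weight_def)
  next
    case (insert c A)
    have c: "c \<notin> insert e A" and eA: "e \<notin> A" using insert by auto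
    have inj: "inj_on X (insert e A)" using insert.prems(2) by (rule inj_on_subset) auto
    have Xc: "X c \<notin> X ` insert e A" using insert.prems(2) c by (auto simp: inj_on_def)
    then have ne: "X i - X c \<noteq> 0" if "i \<in> insert e A" for i using that by (metis image_eqI right_minus_eq)
    let ?w = "residue_weight X Y e A" and ?w' = "residue_weight X Y e (insert c A)"
    let ?I = "insert e A"
    note rec = sum_residue_weight_insert[OF insert.hyps(1) c insert.prems(2)
        residue_weight_partial_fractions[OF insert.hyps(1) eA inj Xc]]
    have IH: "sum ?w ?I = 1" "(\<Sum>i\<in>?I. ?w i * X i) = (\<Sum>j\<in>A. X j - Y j)"
      "(\<Sum>i\<in>?I. ?w i * (X i)\<^sup>2)
        = ((\<Sum>j\<in>A. X j - Y j)\<^sup>2 + (\<Sum>j\<in>A. (X j)\<^sup>2 - (Y j)\<^sup>2)) / 2"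
      using insert.IH[OF eA inj insert.prems(3)] by blast+
    have m0: "(\<Sum>i\<in>insert e (insert c A). ?w' i * 1) = (\<Sum>i\<in>?I. ?w i)"
      unfolding rec by (intro sum.cong refl) (use ne in auto)
    have m1: "(\<Sum>i\<in>insert e (insert c A). ?w' i * X i)
        = (\<Sum>i\<in>?I. ?w i * X i + (X c - Y c) * ?w i)"
      unfolding rec
    proof (intro sum.cong refl)
      fix i assume "i \<in> insert e A"
      then have "((X i - Y c) * X i - (X c - Y c) * X c) / (X i - X c) = X i + (X c - Y c)"
        using ne by (simp add: divide_simps) (simp add: algebra_simps)
      then show "?w i * (((X i - Y c) * X i - (X c - Y c) * X c) / (X i - X c))
         = ?w i * X i + (X c - Y c) * ?w i" by (simp only:) (simp add: algebra_simps)
    qed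
    have m2: "(\<Sum>i\<in>insert e (insert c A). ?w' i * (X i)\<^sup>2)
        = (\<Sum>i\<in>?I. ?w i * (X i)\<^sup>2 + (X c - Y c) * (?w i * X i) + X c * (X c - Y c) * ?w i)"
      unfolding rec
    proof (intro sum.cong refl)
      fix i assume "i \<in> insert e A"
      then have "((X i - Y c) * (X i)\<^sup>2 - (X c - Y c) * (X c)\<^sup>2) / (X i - X c)
          = (X i)\<^sup>2 + (X c - Y c) * X i + X c * (X c - Y c)"
        using ne by (simp add: divide_simps) (simp add: algebra_simps power2_eq_square)
      then show "?w i * (((X i - Y c) * (X i)\<^sup>2 - (X c - Y c) * (X c)\<^sup>2) / (X i - X c))
         = ?w i * (X i)\<^sup>2 + (X c - Y c) * (?w i * X i) + X c * (X c - Y c) * ?w i"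
        by (simp only:) (simp add: algebra_simps)
    qed
    have cA: "c \<notin> A" using c by simp
    \<comment> \<open>With p = \<open>X c - Y c\<close>, the second moment closes up because 2 p X_c
      = p^2 + (X_c^2 - Y_c^2).\<close>
    show ?case
      using m0 m1 m2 insert.hyps(1) cA unfolding sum.distrib sum_distrib_left[symmetric] IH
      by (simp add: field_simps power2_eq_square)
  qed
  then show "(\<Sum>i\<in>insert e A. residue_weight X Y e A i) = 1"
    and "(\<Sum>i\<in>insert e A. residue_weight X Y e A i * X i) = (\<Sum>j\<in>A. X j - Y j)"
    and "(\<Sum>i\<in>insert e A. residue_weight X Y e A i * (X i)\<^sup>2)
      = ((\<Sum>j\<in>A. X j - Y j)\<^sup>2 + (\<Sum>j\<in>A. (X j)\<^sup>2 - (Y j)\<^sup>2)) / 2"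
    by blast+
qed

section \<open>Strict partitions and their diagrams\<close>

lemma part_0 [simp]: "part lam 0 = 0"
  by (simp add: part_def)

lemma part_beyond: "length lam < i \<Longrightarrow> part lam i = 0"
  by (simp add: part_def)

lemma part_pos_iff:
  assumes "strict_partition lam"
  shows "0 < part lam i \<longleftrightarrow> 1 \<le> i \<and> i \<le> length lam"
proof (cases "1 \<le> i \<and> i \<le> length lam")
  case True
  then have "lam ! (i - 1) \<in> set lam" by (intro nth_mem) auto
  with assms True show ?thesis by (auto simp: part_def strict_partition_def)
qed (auto simp: part_def)

lemma part_strict:
  assumes "strict_partition lam" "1 \<le> i" "i < j" "j \<le> length lam"
  shows "part lam j < part lam i"
proof -
  have "lam ! (i - 1) > lam ! (j - 1)"
    using assms by (intro sorted_wrt_nth_less[of "(>)"]) (auto simp: strict_partition_def)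
  with assms show ?thesis by (simp add: part_def)
qed

lemma part_less:
  assumes "strict_partition lam" "1 \<le> i" "i < j" "0 < part lam i"
  shows "part lam j < part lam i"
  using part_strict[OF assms(1,2,3)] part_beyond[of lam j] assms(4) by (cases "j \<le> length lam") auto

lemma part_Suc_less:
  assumes "strict_partition lam" "1 \<le> i"
  shows "part lam (Suc i) < part lam i \<or> part lam (Suc i) = 0"
  using part_less[OF assms, of "Suc i"] part_pos_iff[OF assms(1), of i]
    part_pos_iff[OF assms(1), of "Suc i"] assms(2) by auto

lemma inj_on_part: "strict_partition lam \<Longrightarrow> inj_on (part lam) {1..length lam}"
  by (rule inj_onI) (metis atLeastAtMost_iff less_irrefl linorder_neqE_nat part_strict)

lemma part_eq_pos:
  assumes "strict_partition lam" "part lam i = part lam j" "0 < part lam i"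
  shows "i = j"
  using inj_onD[OF inj_on_part[OF assms(1)] assms(2)] part_pos_iff[OF assms(1), of i]
    part_pos_iff[OF assms(1), of j] assms by simp

text \<open>Row i ends in column \<open>i + part lam i\<close>. The next part is smaller by at least
  one, which offsets the shift of its row by one column, so right ends never move to the
  right.\<close>

lemma part_diff_le:
  assumes "strict_partition lam" "1 \<le> i" "i \<le> j" "0 < part lam j"
  shows "j + part lam j \<le> i + part lam i"
  using assms(3,4)
proof (induction j rule: dec_induct)
  case base
  then show ?case by simp
next
  case (step k)
  have "0 < part lam k"
    using step.prems step.hyps assms(2) part_pos_iff[OF assms(1)] by (metis Suc_leD le_trans)
  then have "part lam (Suc k) < part lam k" using step.hyps assms by (intro part_less) auto
  then show ?case using step.IH \<open>0 < part lam k\<close> by simp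
qed

lemma set_conv_part: "set lam = part lam ` {1..length lam}"
proof -
  have "set lam = (\<lambda>i. lam ! i) ` {0..<length lam}"
    by (auto simp: set_conv_nth)
  also have "{0..<length lam} = (\<lambda>i. i - 1) ` {1..length lam}"
    by (auto simp: image_iff intro!: bexI[of _ "Suc _"])
  finally show ?thesis by (auto simp: part_def image_image)
qed

lemma set_conv_part_pos:
  assumes "strict_partition lam"
  shows "set lam = {part lam i |i. 0 < part lam i}"
  unfolding set_conv_part using part_pos_iff[OF assms] by force

lemma part_in_set: "strict_partition lam \<Longrightarrow> 0 < part lam i \<Longrightarrow> part lam i \<in> set lam"
  by (auto simp: set_conv_part_pos)

lemma bij_betw_part: "strict_partition lam \<Longrightarrow> bij_betw (part lam) {1..length lam} (set lam)"
  unfolding bij_betw_def using inj_on_part set_conv_part by blast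

lemma distinct_strict_partition: "strict_partition lam \<Longrightarrow> distinct lam"
  unfolding strict_partition_def by (induction lam) auto

lemma psize_conv_set: "strict_partition lam \<Longrightarrow> psize lam = \<Sum>(set lam)"
  unfolding psize_def using sum_list_distinct_conv_sum_set[of lam id] distinct_strict_partition by simp

lemma strict_partition_eqI:
  assumes "strict_partition lam" "strict_partition mu" "set lam = set mu"
  shows "lam = mu"
proof -
  have "rev lam = rev mu"
  proof (rule sorted_distinct_set_unique)
    have "sorted_wrt (\<le>) (rev xs)" if "strict_partition xs" for xs :: "nat list"
      using that unfolding strict_partition_def sorted_wrt_rev
      by (auto intro: sorted_wrt_mono_rel[of _ "(>)"])
    then show "sorted (rev lam)" "sorted (rev mu)" using assms by auto
  qed (use assms distinct_strict_partition in auto)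
  then show ?thesis by simp
qed

lemma strict_partition_part_eqI:
  assumes "strict_partition lam" "strict_partition mu" "part lam = part mu"
  shows "lam = mu"
  using assms set_conv_part_pos by (intro strict_partition_eqI) simp_all

lemma strict_partition_of_part:
  assumes p0: "p 0 = 0" and dec: "\<And>i. 1 \<le> i \<Longrightarrow> p (Suc i) < p i \<or> p (Suc i) = 0"
  obtains lam where "strict_partition lam" "part lam = p"
proof -
  \<comment> \<open>Every step before the first zero loses at least one, so a zero occurs at index
    \<open>p 1 + 2\<close> at the latest.\<close>
  have bd: "p (Suc k) = 0 \<or> p (Suc k) + k \<le> p 1" for k
    by (induction k) (use dec in force)+
  have ex: "\<exists>k. p (Suc k) = 0" using bd[of "Suc (p 1)"] by (intro exI[of _ "Suc (p 1)"]) auto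
  define l where "l = (LEAST k. p (Suc k) = 0)"
  have l0: "p (Suc l) = 0" unfolding l_def by (rule LeastI_ex[OF ex])
  have lpos: "0 < p i" if "1 \<le> i" "i \<le> l" for i
    using not_less_Least[of "i - 1" "\<lambda>k. p (Suc k) = 0"] that by (auto simp: l_def)
  have zero: "p i = 0" if "l < i" for i
  proof -
    have "Suc l \<le> i" using that by simp
    then show ?thesis
    proof (induction i rule: dec_induct)
      case (step n) then show ?case using dec[of n] by auto
    qed (rule l0)
  qed
  have less: "p j < p i" if "1 \<le> i" "i < j" "j \<le> l" for i j
    using that(2,3)
  proof (induction j)
    case 0 then show ?case by simp
  next
    case (Suc j)
    have "p (Suc j) < p j" using dec[of j] lpos[of "Suc j"] Suc that by auto
    then show ?case using Suc by (cases "i = j") auto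
  qed
  define lam where "lam = map p [1..<Suc l]"
  have "strict_partition lam"
    unfolding strict_partition_def lam_def
    using lpos less by (auto simp: sorted_wrt_iff_nth_less simp del: upt_Suc)
  moreover have "part lam = p"
    using zero p0 by (auto simp: lam_def part_def fun_eq_iff not_le simp del: upt_Suc)
  ultimately show ?thesis using that by blast
qed

section \<open>Shifted diagrams as order ideals, and sums over their contents\<close>

lemma shifted_diagram_iff: "(i, j) \<in> shifted_diagram lam \<longleftrightarrow> 1 \<le> i \<and> i < j \<and> j \<le> i + part lam i"
  unfolding shifted_diagram_def part_def by auto

lemma shifted_diagram_downward:
  assumes "strict_partition lam" "(i', j') \<in> shifted_diagram lam" "1 \<le> i" "i \<le> i'" "i < j" "j \<le> j'"
  shows "(i, j) \<in> shifted_diagram lam"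
  using assms part_diff_le[of lam i i'] by (auto simp: shifted_diagram_iff)

lemma shifted_diagram_Sigma:
  "shifted_diagram lam = Sigma {1..length lam} (\<lambda>i. {i<..i + part lam i})"
  unfolding shifted_diagram_def by auto

lemma finite_shifted_diagram [simp]: "finite (shifted_diagram lam)"
  unfolding shifted_diagram_Sigma by auto

text \<open>The contents in row i are exactly 1, ..., \<open>part lam i\<close>; this is why content
  sums depend only on the set of parts.\<close>

lemma sum_shifted_diagram:
  assumes "strict_partition lam"
  shows "(\<Sum>b\<in>shifted_diagram lam. f (snd b - fst b)) = (\<Sum>a\<in>set lam. \<Sum>c=1..a. f c)"
proof -
  have "(\<Sum>b\<in>shifted_diagram lam. f (snd b - fst b))
      = (\<Sum>i\<in>{1..length lam}. \<Sum>j\<in>{i<..i + part lam i}. f (j - i))"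
    unfolding shifted_diagram_Sigma by (subst sum.Sigma) (auto simp: case_prod_beta)
  also have "\<dots> = (\<Sum>i\<in>{1..length lam}. \<Sum>c=1..part lam i. f c)"
  proof (rule sum.cong)
    fix i
    show "(\<Sum>j\<in>{i<..i + part lam i}. f (j - i)) = (\<Sum>c=1..part lam i. f c)"
      by (rule sum.reindex_bij_witness[of _ "\<lambda>c. i + c" "\<lambda>j. j - i"]) auto
  qed simp
  also have "\<dots> = (\<Sum>a\<in>set lam. \<Sum>c=1..a. f c)"
    by (rule sum.reindex_bij_betw[OF bij_betw_part[OF assms]])
  finally show ?thesis .
qed

lemma card_shifted_diagram:
  assumes "strict_partition lam"
  shows "card (shifted_diagram lam) = psize lam"
  using sum_shifted_diagram[OF assms, of "\<lambda>_. 1::nat"] by (simp add: psize_conv_set[OF assms])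

lemma contains_iff_diagram: "contains lam mu \<longleftrightarrow> shifted_diagram mu \<subseteq> shifted_diagram lam"
proof
  assume sub: "shifted_diagram mu \<subseteq> shifted_diagram lam"
  have "part mu i \<le> part lam i" for i
  proof (cases "part mu i = 0")
    case False
    then have "1 \<le> i" by (cases i) auto
    then have "(i, i + part mu i) \<in> shifted_diagram mu" using False by (simp add: shifted_diagram_iff)
    then have "(i, i + part mu i) \<in> shifted_diagram lam" using sub by blast
    then show ?thesis by (simp add: shifted_diagram_iff)
  qed simp
  then show "contains lam mu" by (simp add: contains_def)
next
  assume c: "contains lam mu"
  then have "i + part mu i \<le> i + part lam i" for i by (simp add: contains_def)
  then show "shifted_diagram mu \<subseteq> shifted_diagram lam"
    unfolding subset_iff by (auto simp only: split_paired_All shifted_diagram_iff) (meson order_trans)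
qed

lemma part_eqI_diagram:
  assumes "shifted_diagram lam = shifted_diagram mu"
  shows "part lam = part mu"
proof
  fix i
  have "contains lam mu" "contains mu lam" using assms by (simp_all add: contains_iff_diagram)
  then show "part lam i = part mu i" by (simp add: contains_def order_antisym)
qed

lemma contains_imp_psize_le:
  assumes "strict_partition lam" "strict_partition mu" "contains lam mu"
  shows "psize mu \<le> psize lam"
  using card_mono[OF finite_shifted_diagram assms(3)[unfolded contains_iff_diagram]]
  by (simp only: card_shifted_diagram assms)

lemma contains_psize_eq:
  assumes "strict_partition lam" "strict_partition mu" "contains lam mu" "psize lam = psize mu"
  shows "lam = mu"
proof -
  have "shifted_diagram mu = shifted_diagram lam"
    using assms(3,4) by (intro card_subset_eq) (simp_all add: card_shifted_diagram[OF assms(1)]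
        card_shifted_diagram[OF assms(2)] contains_iff_diagram)
  then show ?thesis by (intro strict_partition_part_eqI[OF assms(1,2)] part_eqI_diagram) (rule sym)
qed

lemma finite_strict_partitions: "finite {lam. strict_partition lam \<and> psize lam = N}"
proof -
  have "{lam. strict_partition lam \<and> psize lam = N}
      \<subseteq> {lam. set lam \<subseteq> {..N} \<and> distinct lam}"
    using member_le_sum_list unfolding psize_def by (auto simp: distinct_strict_partition)
  moreover have "finite {lam. set lam \<subseteq> {..N} \<and> distinct lam}"
    by (rule finite_subset_distinct) simp
  ultimately show ?thesis by (rule finite_subset)
qed

text \<open>Stated through \<open>part\<close> instead of lists, so that opening a new row, i =
  \<open>length nu + 1\<close> with old part 0, falls under the same formula as lengthening an
  existing row.\<close>

definition covers :: "nat list \<Rightarrow> nat list \<Rightarrow> bool" where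
  "covers lam nu \<longleftrightarrow> strict_partition lam \<and> strict_partition nu \<and>
     (\<exists>i\<ge>1. part lam = (part nu)(i := Suc (part nu i)))"

lemma part_upd_diagram:
  assumes "1 \<le> i"
  shows "part lam = (part nu)(i := Suc (part nu i)) \<longleftrightarrow>
    (i, i + Suc (part nu i)) \<notin> shifted_diagram nu \<and>
    shifted_diagram lam = insert (i, i + Suc (part nu i)) (shifted_diagram nu)"
proof
  assume "part lam = (part nu)(i := Suc (part nu i))"
  then show "(i, i + Suc (part nu i)) \<notin> shifted_diagram nu \<and>
    shifted_diagram lam = insert (i, i + Suc (part nu i)) (shifted_diagram nu)"
    using assms by (auto simp: shifted_diagram_iff split: if_splits)
next
  assume R: "(i, i + Suc (part nu i)) \<notin> shifted_diagram nu \<and>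
    shifted_diagram lam = insert (i, i + Suc (part nu i)) (shifted_diagram nu)"
  have le: "part nu k \<le> part lam k" for k
    using R contains_iff_diagram[of lam nu] by (auto simp: contains_def)
  have "part lam k = ((part nu)(i := Suc (part nu i))) k" for k
  proof (cases "part lam k = part nu k")
    case True
    moreover have "(i, i + Suc (part nu i)) \<in> shifted_diagram lam" using R by simp
    ultimately show ?thesis by (auto simp: shifted_diagram_iff)
  next
    case False
    then have lt: "part nu k < part lam k" using le[of k] by simp
    then have "1 \<le> k" by (cases k) auto
    then have "(k, k + part lam k) \<in> shifted_diagram lam - shifted_diagram nu"
      using lt by (simp add: shifted_diagram_iff)
    then show ?thesis using R by auto
  qed
  then show "part lam = (part nu)(i := Suc (part nu i))" by blast
qed

lemma set_covers:
  assumes lam: "strict_partition lam" and nu: "strict_partition nu" and i: "1 \<le> i"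
    and upd: "part lam = (part nu)(i := Suc (part nu i))"
  shows "part nu i \<in> insert 0 (set nu)" "Suc (part nu i) \<notin> set nu"
    "set lam = insert (Suc (part nu i)) (set nu - {part nu i})"
proof -
  show "part nu i \<in> insert 0 (set nu)"
    using set_conv_part_pos[OF nu] by auto
  show "Suc (part nu i) \<notin> set nu"
  proof
    assume "Suc (part nu i) \<in> set nu"
    then obtain k where k: "part nu k = Suc (part nu i)" using set_conv_part_pos[OF nu] by auto
    then have "k \<noteq> i" by auto
    then have "part lam k = part lam i" "0 < part lam k" using upd k by simp_all
    with \<open>k \<noteq> i\<close> show False using part_eq_pos[OF lam] by blast
  qed
  show "set lam = insert (Suc (part nu i)) (set nu - {part nu i})"
  proof (intro set_eqI iffI)
    fix x assume "x \<in> set lam"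
    then obtain k where k: "x = part lam k" "0 < part lam k" using set_conv_part_pos[OF lam] by auto
    show "x \<in> insert (Suc (part nu i)) (set nu - {part nu i})"
    proof (cases "k = i")
      case False
      then have x: "x = part nu k" "0 < x" using k upd by auto
      then have "x \<noteq> part nu i" using part_eq_pos[OF nu, of k i] False by auto
      then show ?thesis using x set_conv_part_pos[OF nu] by auto
    qed (use k upd in simp)
  next
    fix x assume "x \<in> insert (Suc (part nu i)) (set nu - {part nu i})"
    then consider "x = part lam i" "0 < x" | k where "x = part nu k" "0 < x" "k \<noteq> i"
      using upd set_conv_part_pos[OF nu] by auto
    then show "x \<in> set lam"
    proof cases
      case 2
      then have "x = part lam k" using upd by simp
      then show ?thesis using 2 set_conv_part_pos[OF lam] by auto
    qed (use set_conv_part_pos[OF lam] in auto)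
  qed
qed

text \<open>The only obstruction to lengthening a row of length \<open>a\<close> is a row above it
  of length \<open>a + 1\<close>; since parts are distinct, this is the condition
  \<open>Suc a \<notin> set nu\<close>.\<close>

lemma add_box:
  assumes nu: "strict_partition nu" and a: "a \<in> insert 0 (set nu)" "Suc a \<notin> set nu"
  obtains lam where "covers lam nu" "set lam = insert (Suc a) (set nu - {a})"
proof -
  obtain i where i: "1 \<le> i" "part nu i = a" "i \<le> Suc (length nu)"
  proof (cases "a = 0")
    case True
    then show ?thesis using that[of "Suc (length nu)"] by (simp add: part_beyond)
  next
    case False
    then show ?thesis using a that by (auto simp: set_conv_part)
  qed
  let ?p = "(part nu)(i := Suc a)"
  have p0: "?p 0 = 0" using i by simp
  have dec: "?p (Suc k) < ?p k \<or> ?p (Suc k) = 0" if "1 \<le> k" for k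
  proof (cases "Suc k = i")
    case True
    have pos: "0 < part nu k" using True i that by (simp add: part_pos_iff[OF nu])
    then have "a < part nu k" using part_less[OF nu that, of "Suc k"] True i by simp
    moreover have "part nu k \<noteq> Suc a" using part_in_set[OF nu pos] a(2) by auto
    ultimately show ?thesis using True by auto
  next
    case False
    then show ?thesis using part_Suc_less[OF nu that] i by auto
  qed
  obtain lam where lam: "strict_partition lam" "part lam = ?p"
    by (rule strict_partition_of_part[OF p0 dec])
  have "covers lam nu" unfolding covers_def using nu lam i by auto
  moreover have "set lam = insert (Suc a) (set nu - {a})"
    using set_covers(3)[OF lam(1) nu i(1)] lam(2) i(2) by simp
  ultimately show ?thesis using that by blast
qed

lemma covers_iff_set:
  "covers lam nu \<longleftrightarrow> strict_partition lam \<and> strict_partition nu \<and>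
     (\<exists>a\<in>insert 0 (set nu). Suc a \<notin> set nu \<and> set lam = insert (Suc a) (set nu - {a}))"
proof
  assume "covers lam nu"
  then show "strict_partition lam \<and> strict_partition nu \<and>
     (\<exists>a\<in>insert 0 (set nu). Suc a \<notin> set nu \<and> set lam = insert (Suc a) (set nu - {a}))"
    unfolding covers_def using set_covers by meson
next
  assume R: "strict_partition lam \<and> strict_partition nu \<and>
     (\<exists>a\<in>insert 0 (set nu). Suc a \<notin> set nu \<and> set lam = insert (Suc a) (set nu - {a}))"
  then obtain a where a: "a \<in> insert 0 (set nu)" "Suc a \<notin> set nu" "set lam = insert (Suc a) (set nu - {a})"
    by blast
  obtain lam' where "covers lam' nu" "set lam' = insert (Suc a) (set nu - {a})"
    using add_box[of nu a] a R by blast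
  moreover have "lam = lam'"
    using R a calculation by (intro strict_partition_eqI) (auto simp: covers_def)
  ultimately show "covers lam nu" by simp
qed

lemma sum_covers:
  assumes nu: "strict_partition nu"
  shows "(\<Sum>lam | covers lam nu. f (set lam))
    = (\<Sum>a\<in>{a \<in> insert 0 (set nu). Suc a \<notin> set nu}. f (insert (Suc a) (set nu - {a})))"
proof (rule sym)
  let ?A = "{a \<in> insert 0 (set nu). Suc a \<notin> set nu}"
  let ?g = "\<lambda>a. insert (Suc a) (set nu - {a})"
  have inj: "inj_on ?g ?A"
  proof (rule inj_onI)
    fix a b assume "a \<in> ?A" "b \<in> ?A" "?g a = ?g b"
    \<comment> \<open>\<open>Suc a\<close> is the only element of \<open>?g a\<close> outside
      \<open>set nu\<close>, so the image determines \<open>a\<close>.\<close>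
    then have "Suc a \<in> ?g b" "Suc a \<notin> set nu" by auto
    then show "a = b" by auto
  qed
  have inj': "inj_on set {lam. covers lam nu}"
    by (rule inj_onI) (auto simp: covers_def intro: strict_partition_eqI)
  have img: "?g ` ?A = set ` {lam. covers lam nu}"
  proof (intro equalityI subsetI)
    fix S assume "S \<in> ?g ` ?A"
    then obtain a where "a \<in> ?A" "S = ?g a" by blast
    moreover then obtain lam where "covers lam nu" "set lam = ?g a" using add_box[OF nu, of a] by blast
    ultimately show "S \<in> set ` {lam. covers lam nu}" by blast
  qed (auto simp: covers_iff_set)
  show "(\<Sum>a\<in>?A. f (?g a)) = (\<Sum>lam | covers lam nu. f (set lam))"
    using sum.reindex[OF inj, of f] sum.reindex[OF inj', of f] img by simp
qed

lemma covers_psize: "covers lam nu \<Longrightarrow> psize lam = Suc (psize nu)"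
proof -
  assume "covers lam nu"
  then obtain a where a: "strict_partition lam" "strict_partition nu" "a \<in> insert 0 (set nu)"
    "Suc a \<notin> set nu" "set lam = insert (Suc a) (set nu - {a})" by (auto simp: covers_iff_set)
  have "\<Sum>(set lam) = Suc a + \<Sum>(set nu - {a})" using a by simp
  moreover have "\<Sum>(set nu) = a + \<Sum>(set nu - {a})"
    using a(3) by (cases "a \<in> set nu") (auto simp: sum.remove)
  ultimately show ?thesis using a psize_conv_set by simp
qed

lemma covers_contains: "covers lam nu \<Longrightarrow> contains lam nu"
  unfolding covers_def contains_def by auto

section \<open>Counting standard tableaux\<close>

text \<open>Standard tableaux without geometry: only a finite set and a relation remain, which is
  all that removing the largest label requires.\<close>

definition linear_fillings :: "('a \<Rightarrow> 'a \<Rightarrow> bool) \<Rightarrow> 'a set \<Rightarrow> ('a \<Rightarrow> nat) set" where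
  "linear_fillings r K = {T. bij_betw T K {1..card K} \<and> (\<forall>b. b \<notin> K \<longrightarrow> T b = 0) \<and>
     (\<forall>p\<in>K. \<forall>q\<in>K. r p q \<longrightarrow> T p < T q)}"

lemma finite_linear_fillings:
  assumes "finite K"
  shows "finite (linear_fillings r K)"
proof (rule finite_subset)
  show "linear_fillings r K \<subseteq> {T. \<forall>b. (b \<in> K \<longrightarrow> T b \<in> {1..card K}) \<and> (b \<notin> K \<longrightarrow> T b = 0)}"
    by (auto simp: linear_fillings_def dest: bij_betwE)
  show "finite {T. \<forall>b. (b \<in> K \<longrightarrow> T b \<in> {1..card K}) \<and> (b \<notin> K \<longrightarrow> T b = 0)}"
    by (rule finite_set_of_finite_funs) (use assms in auto)
qed

text \<open>Erasing the label of \<open>b\<close> is invertible: putting \<open>card K\<close> back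
  violates no constraint, because nothing in \<open>K\<close> lies above \<open>b\<close> and all
  other labels are smaller.\<close>

lemma card_linear_fillings_max:
  assumes fin: "finite K" and b: "b \<in> K" and max: "\<And>q. q \<in> K \<Longrightarrow> \<not> r b q"
  shows "card {T \<in> linear_fillings r K. T b = card K} = card (linear_fillings r (K - {b}))"
proof -
  define L where "L = K - {b}"
  have K: "K = L \<union> {b}" and bL: "b \<notin> L" and finL: "finite L" using b fin by (auto simp: L_def)
  have cK: "card K = Suc (card L)" using bL finL by (simp add: K)
  have iv: "{1..card K} = {1..card L} \<union> {Suc (card L)}" by (auto simp: cK)
  have bij: "bij_betw T K {1..card K} \<longleftrightarrow> bij_betw T L {1..card L}" if "T b = card K" for T
    using notIn_Un_bij_betw3[of b L T "{1..card L}"] bL that cK iv by (simp add: K)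
  have upd: "bij_betw (T(b := x)) L M \<longleftrightarrow> bij_betw T L M" for T x and M :: "nat set"
    by (rule bij_betw_cong) (use bL in auto)
  have "bij_betw (\<lambda>T. T(b := 0)) {T \<in> linear_fillings r K. T b = card K} (linear_fillings r L)"
  proof (rule bij_betw_byWitness[where f' = "\<lambda>T. T(b := card K)"])
    show "\<forall>T\<in>{T \<in> linear_fillings r K. T b = card K}. (T(b := 0))(b := card K) = T"
      by auto
    show "\<forall>T\<in>linear_fillings r L. (T(b := card K))(b := 0) = T"
      using bL by (auto simp: linear_fillings_def)
    show "(\<lambda>T. T(b := 0)) ` {T \<in> linear_fillings r K. T b = card K} \<subseteq> linear_fillings r L"
    proof (intro image_subsetI)
      fix T assume T: "T \<in> {T \<in> linear_fillings r K. T b = card K}"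
      then have "bij_betw (T(b := 0)) L {1..card L}"
        using bij[of T] upd[of T 0] by (simp add: linear_fillings_def)
      then show "T(b := 0) \<in> linear_fillings r L"
        using T bL by (auto simp: linear_fillings_def K)
    qed
    show "(\<lambda>T. T(b := card K)) ` linear_fillings r L \<subseteq> {T \<in> linear_fillings r K. T b = card K}"
    proof (intro image_subsetI)
      fix T assume T: "T \<in> linear_fillings r L"
      then have TL: "bij_betw T L {1..card L}" by (simp add: linear_fillings_def)
      then have "bij_betw (T(b := card K)) K {1..card K}"
        using bij[of "T(b := card K)"] upd[of T "card K"] by simp
      moreover have "T p < card K" if "p \<in> L" for p
        using bij_betwE[OF TL] that cK by (metis atLeastAtMost_iff le_imp_less_Suc)
      moreover have "\<not> r b q" if "q \<in> L \<union> {b}" for q using max that K by blast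
      ultimately show "T(b := card K) \<in> {T \<in> linear_fillings r K. T b = card K}"
        using T bL by (auto simp: linear_fillings_def K)
    qed
  qed
  then show ?thesis using bij_betw_same_card unfolding L_def by blast
qed

text \<open>The fillings are split by the position of the largest label, which can only be an
  element with nothing above it.\<close>

lemma card_linear_fillings_rec:
  assumes fin: "finite K" and ne: "K \<noteq> {}" and irr: "\<And>p. \<not> r p p"
  shows "card (linear_fillings r K)
    = (\<Sum>b\<in>{b \<in> K. \<forall>q\<in>K. \<not> r b q}. card (linear_fillings r (K - {b})))"
proof -
  let ?M = "{b \<in> K. \<forall>q\<in>K. \<not> r b q}"
  let ?C = "\<lambda>b. {T \<in> linear_fillings r K. T b = card K}"
  have "linear_fillings r K = (\<Union>b\<in>?M. ?C b)"
  proof (intro equalityI subsetI)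
    fix T assume T: "T \<in> linear_fillings r K"
    then have bij: "bij_betw T K {1..card K}" by (simp add: linear_fillings_def)
    have "card K \<in> {1..card K}" using fin ne by (auto simp: Suc_le_eq card_gt_0_iff)
    then obtain b where b: "b \<in> K" "T b = card K"
      using bij by (metis bij_betw_imp_surj_on imageE)
    have "T q \<le> card K" if "q \<in> K" for q using bij_betwE[OF bij] that by auto
    then have "\<not> r b q" if "q \<in> K" for q
      using T b that by (fastforce simp: linear_fillings_def)
    then show "T \<in> (\<Union>b\<in>?M. ?C b)" using T b by blast
  qed auto
  then have "card (linear_fillings r K) = card (\<Union>b\<in>?M. ?C b)" by simp
  also have "\<dots> = (\<Sum>b\<in>?M. card (?C b))"
  proof (rule card_UN_disjoint)
    show "\<forall>i\<in>?M. \<forall>j\<in>?M. i \<noteq> j \<longrightarrow> ?C i \<inter> ?C j = {}"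
    proof (intro ballI impI equalityI subsetI)
      fix i j T assume "i \<in> ?M" "j \<in> ?M" "i \<noteq> j" "T \<in> ?C i \<inter> ?C j"
      then have "inj_on T K" "i \<in> K" "j \<in> K" "T i = T j"
        by (auto simp: linear_fillings_def bij_betw_def)
      then show "T \<in> {}" using \<open>i \<noteq> j\<close> by (auto dest: inj_onD)
    qed simp
  qed (use fin finite_linear_fillings[OF fin] in auto)
  also have "\<dots> = (\<Sum>b\<in>?M. card (linear_fillings r (K - {b})))"
    by (intro sum.cong refl card_linear_fillings_max[OF fin]) auto
  finally show ?thesis .
qed

definition box_less :: "nat \<times> nat \<Rightarrow> nat \<times> nat \<Rightarrow> bool" where
  "box_less p q \<longleftrightarrow> fst p = fst q \<and> snd p < snd q \<or> snd p = snd q \<and> fst p < fst q"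

lemma num_syt_linear_fillings: "num_syt lam mu = card (linear_fillings box_less (skew lam mu))"
  unfolding num_syt_def linear_fillings_def box_less_def
  by (rule arg_cong[where f = card], rule Collect_cong) auto

lemma num_syt_same [simp]: "num_syt mu mu = 1"
proof -
  have "linear_fillings box_less {} = {\<lambda>_. 0}"
    by (auto simp: linear_fillings_def bij_betw_def)
  then show ?thesis by (simp add: num_syt_linear_fillings skew_def)
qed

lemma covers_skew:
  assumes "covers lam nu"
  obtains b where "b \<notin> shifted_diagram nu" "shifted_diagram lam = insert b (shifted_diagram nu)"
  using assms part_upd_diagram unfolding covers_def by blast

text \<open>The shortened row must still be longer than the next one, hence the gap of at least two.
  If the next row is empty, even a row with a single box may disappear.\<close>

lemma remove_box:
  assumes lam: "strict_partition lam" and pos: "0 < part lam i"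
    and below: "Suc (part lam (Suc i)) < part lam i \<or> part lam (Suc i) = 0"
  obtains nu where "covers lam nu" "shifted_diagram nu = shifted_diagram lam - {(i, i + part lam i)}"
proof -
  have i: "1 \<le> i" using pos by (cases i) auto
  define p where "p = (part lam)(i := part lam i - 1)"
  have p0: "p 0 = 0" using i by (simp add: p_def)
  have dec: "p (Suc k) < p k \<or> p (Suc k) = 0" if "1 \<le> k" for k
    using part_Suc_less[OF lam that] below i by (auto simp: p_def)
  obtain nu where nu: "strict_partition nu" "part nu = p" by (rule strict_partition_of_part[OF p0 dec])
  have upd: "part lam = (part nu)(i := Suc (part nu i))" using i pos nu by (auto simp: p_def)
  then have cov: "covers lam nu" using lam nu i by (auto simp: covers_def)
  have "part lam i = Suc (part nu i)" using upd by (metis fun_upd_same)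
  then have "(i, i + part lam i) \<notin> shifted_diagram nu"
    "shifted_diagram lam = insert (i, i + part lam i) (shifted_diagram nu)"
    using upd part_upd_diagram[OF i, of lam nu] by simp_all
  then have "shifted_diagram nu = shifted_diagram lam - {(i, i + part lam i)}" by simp
  then show ?thesis using that cov by blast
qed

text \<open>If the box were not a corner of \<open>lam\<close>, then its right or lower neighbour
  would lie in \<open>lam\<close>. That neighbour cannot lie in \<open>mu\<close>, since
  \<open>mu\<close> is an order ideal missing the box, so the box would not be maximal in the skew
  shape.\<close>

lemma maximal_box_removable:
  assumes lam: "strict_partition lam" and mu: "strict_partition mu"
    and sub: "contains lam mu" and b: "b \<in> skew lam mu" and max: "\<forall>q\<in>skew lam mu. \<not> box_less b q"
  obtains nu where "covers lam nu" "contains nu mu" "shifted_diagram nu = shifted_diagram lam - {b}"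
proof -
  obtain i j where ij: "b = (i, j)" by (cases b)
  have b1: "1 \<le> i" "i < j" "j \<le> i + part lam i" and bmu: "(i, j) \<notin> shifted_diagram mu"
    using b by (auto simp: ij skew_def shifted_diagram_iff)
  have j: "j = i + part lam i"
  proof (rule ccontr)
    assume "j \<noteq> i + part lam i"
    then have "(i, Suc j) \<in> shifted_diagram lam" using b1 by (simp add: shifted_diagram_iff)
    moreover have "(i, Suc j) \<notin> shifted_diagram mu"
      using bmu shifted_diagram_downward[OF mu, of i "Suc j" i j] b1 by auto
    ultimately show False using max[rule_format, of "(i, Suc j)"] by (simp add: skew_def box_less_def ij)
  qed
  have below: "Suc (part lam (Suc i)) < part lam i \<or> part lam (Suc i) = 0"
  proof (rule ccontr)
    assume "\<not> ?thesis"
    then have "part lam i = Suc (part lam (Suc i))" "0 < part lam (Suc i)"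
      using part_less[OF lam b1(1), of "Suc i"] b1 by auto
    \<comment> \<open>A next row shorter by exactly one ends in the same column
      \<open>j\<close>.\<close>
    then have "(Suc i, j) \<in> shifted_diagram lam" using j by (simp add: shifted_diagram_iff)
    moreover have "(Suc i, j) \<notin> shifted_diagram mu"
      using bmu shifted_diagram_downward[OF mu, of "Suc i" j i j] b1 by auto
    ultimately show False using max[rule_format, of "(Suc i, j)"] by (simp add: skew_def box_less_def ij)
  qed
  obtain nu where nu: "covers lam nu" "shifted_diagram nu = shifted_diagram lam - {(i, i + part lam i)}"
    by (rule remove_box[OF lam _ below]) (use b1 j in simp)
  have "contains nu mu" using sub bmu nu j by (auto simp: contains_iff_diagram)
  then show ?thesis using that nu j ij by blast
qed

text \<open>The possible positions of the largest entry correspond to the strict partitions between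
  \<open>mu\<close> and \<open>lam\<close> with one box less than \<open>lam\<close>;
  \<open>box\<close> is this bijection.\<close>

lemma num_syt_rec:
  assumes lam: "strict_partition lam" and mu: "strict_partition mu"
    and sub: "contains lam mu" and less: "psize mu < psize lam"
  shows "num_syt lam mu = (\<Sum>nu | covers lam nu \<and> contains nu mu. num_syt nu mu)"
proof -
  let ?K = "skew lam mu"
  let ?M = "{b \<in> ?K. \<forall>q\<in>?K. \<not> box_less b q}"
  let ?S = "{nu. covers lam nu \<and> contains nu mu}"
  define box where "box nu = the_elem (shifted_diagram lam - shifted_diagram nu)" for nu
  have fin: "finite ?K" by (simp add: skew_def)
  have "?K \<noteq> {}"
  proof
    assume "?K = {}"
    then have "contains mu lam" by (auto simp: skew_def contains_iff_diagram)
    then show False using contains_imp_psize_le[OF mu lam] less by simp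
  qed
  note rec = card_linear_fillings_rec[OF fin this, of box_less]
  have box: "box nu \<notin> shifted_diagram nu" "shifted_diagram lam = insert (box nu) (shifted_diagram nu)"
    if cov: "covers lam nu" for nu
  proof -
    obtain b where b: "b \<notin> shifted_diagram nu" "shifted_diagram lam = insert b (shifted_diagram nu)"
      using covers_skew[OF cov] by blast
    then have "shifted_diagram lam - shifted_diagram nu = {b}" by auto
    then have "box nu = b" by (simp add: box_def)
    then show "box nu \<notin> shifted_diagram nu" "shifted_diagram lam = insert (box nu) (shifted_diagram nu)"
      using b by auto
  qed
  have "bij_betw box ?S ?M"
    unfolding bij_betw_def
  proof (intro conjI equalityI image_subsetI subsetI)
    show "inj_on box ?S"
    proof (rule inj_onI)
      fix nu nu' assume S: "nu \<in> ?S" "nu' \<in> ?S" "box nu = box nu'"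
      then have "shifted_diagram nu = shifted_diagram nu'"
        using box[of nu] box[of nu'] by (metis (no_types, lifting) Diff_insert_absorb mem_Collect_eq)
      then show "nu = nu'"
        using S by (intro strict_partition_part_eqI part_eqI_diagram) (auto simp: covers_def)
    qed
  next
    fix nu assume nu: "nu \<in> ?S"
    then have cov: "covers lam nu" and nmu: "shifted_diagram mu \<subseteq> shifted_diagram nu"
      by (simp_all add: contains_iff_diagram)
    note b = box[OF cov]
    have snu: "strict_partition nu" using cov by (simp add: covers_def)
    have "box nu \<in> ?K" using b nmu by (auto simp: skew_def)
    moreover have "\<not> box_less (box nu) q" if q: "q \<in> ?K" for q
    proof
      assume less: "box_less (box nu) q"
      then have "q \<noteq> box nu" by (auto simp: box_less_def)
      then have qnu: "q \<in> shifted_diagram nu" using q b by (auto simp: skew_def)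
      have "box nu \<in> shifted_diagram lam" using b by simp
      then have "1 \<le> fst (box nu)" "fst (box nu) < snd (box nu)"
        by (cases "box nu"; simp add: shifted_diagram_iff)+
      \<comment> \<open>A box of \<open>nu\<close> to the right of or below \<open>box nu\<close>
        would drag \<open>box nu\<close> into the order ideal \<open>nu\<close>.\<close>
      then have "box nu \<in> shifted_diagram nu"
        using shifted_diagram_downward[OF snu, of "fst q" "snd q" "fst (box nu)" "snd (box nu)"] qnu less
        by (auto simp: box_less_def)
      then show False using b by simp
    qed
    ultimately show "box nu \<in> ?M" by simp
  next
    fix b assume "b \<in> ?M"
    then have b: "b \<in> ?K" "\<forall>q\<in>?K. \<not> box_less b q" by auto
    obtain nu where nu: "covers lam nu" "contains nu mu" "shifted_diagram nu = shifted_diagram lam - {b}"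
      by (rule maximal_box_removable[OF lam mu sub b])
    have "shifted_diagram lam - shifted_diagram nu = {b}" using nu(3) b(1) by (auto simp: skew_def)
    then have "box nu = b" by (simp add: box_def)
    then show "b \<in> box ` ?S" using nu by blast
  qed
  then have "(\<Sum>b\<in>?M. card (linear_fillings box_less (?K - {b})))
      = (\<Sum>nu\<in>?S. card (linear_fillings box_less (?K - {box nu})))"
    by (rule sum.reindex_bij_betw[symmetric])
  also have "\<dots> = (\<Sum>nu\<in>?S. num_syt nu mu)"
  proof (rule sum.cong)
    fix nu assume "nu \<in> ?S"
    then have "?K - {box nu} = skew nu mu"
      using box[of nu] by (auto simp: skew_def)
    then show "card (linear_fillings box_less (?K - {box nu})) = num_syt nu mu"
      by (simp add: num_syt_linear_fillings)
  qed simp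
  finally show ?thesis
    using rec by (simp add: num_syt_linear_fillings box_less_def)
qed

section \<open>Content sums and outer corners\<close>

lemma choose_5_Suc: "(Suc a + 2) choose 5 = ((a + 2) choose 5) + ((a + 2) choose 4)"
  using binomial_Suc_Suc[of "a + 2" 4] by (simp add: eval_nat_numeral)

text \<open>Hockey-stick identity; the terms for c = 1 and c = 2 vanish.\<close>

lemma sum_choose_4: "(\<Sum>c=1..a. real ((c + 1) choose 4)) = real ((a + 2) choose 5)"
proof (induction a)
  case (Suc a)
  then show ?case by (simp add: choose_5_Suc[simplified])
qed (simp add: eval_nat_numeral)

lemma sum_content_binom4:
  assumes "strict_partition lam"
  shows "(\<Sum>b\<in>shifted_diagram lam. content_binom4 b) = (\<Sum>a\<in>set lam. real ((a + 2) choose 5))"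
proof -
  have "(\<Sum>b\<in>shifted_diagram lam. content_binom4 b)
      = (\<Sum>b\<in>shifted_diagram lam. real ((snd b - fst b + 1) choose 4))"
  proof (rule sum.cong)
    fix b assume "b \<in> shifted_diagram lam"
    then have "fst b < snd b" by (cases b) (simp add: shifted_diagram_iff)
    then have "nat (content b + 1) = snd b - fst b + 1" by (simp add: content_def)
    then show "content_binom4 b = real ((snd b - fst b + 1) choose 4)"
      by (simp add: content_binom4_def)
  qed simp
  then show ?thesis
    using sum_shifted_diagram[OF assms, of "\<lambda>c. real ((c + 1) choose 4)"] by (simp only: sum_choose_4)
qed

text \<open>A removed box leaves an order ideal only if nothing lies to its right or below it: it
  ends its row, and the next row stops short of its column. The converse is
  \<open>remove_box\<close>.\<close>

lemma outer_corners_conv: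
  assumes mu: "strict_partition mu"
  shows "outer_corners mu = (\<lambda>i. (i, i + part mu i)) `
    {i. 0 < part mu i \<and> (Suc (part mu (Suc i)) < part mu i \<or> part mu (Suc i) = 0)}"
    (is "_ = ?g ` ?R")
proof (intro equalityI subsetI)
  fix b assume "b \<in> outer_corners mu"
  then obtain nu where b: "b \<in> shifted_diagram mu" and nu: "strict_partition nu"
    and D: "shifted_diagram nu = shifted_diagram mu - {b}" by (auto simp: outer_corners_def)
  obtain i j where ij: "b = (i, j)" by (cases b)
  have b1: "1 \<le> i" "i < j" "j \<le> i + part mu i" using b by (auto simp: ij shifted_diagram_iff)
  have not: "q \<notin> shifted_diagram nu" if "i \<le> fst q" "j \<le> snd q" for q
    using shifted_diagram_downward[OF nu, of "fst q" "snd q" i j] that b1 D ij by auto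
  have j: "j = i + part mu i"
  proof (rule ccontr)
    assume "j \<noteq> i + part mu i"
    then have "(i, Suc j) \<in> shifted_diagram nu" using b1 by (simp add: D ij shifted_diagram_iff)
    then show False using not[of "(i, Suc j)"] by simp
  qed
  have "i \<in> ?R"
  proof (rule ccontr)
    assume "i \<notin> ?R"
    then have "part mu i = Suc (part mu (Suc i))" "0 < part mu (Suc i)"
      using part_less[OF mu b1(1), of "Suc i"] b1 by auto
    then have "(Suc i, j) \<in> shifted_diagram nu" using j by (simp add: D ij shifted_diagram_iff)
    then show False using not[of "(Suc i, j)"] by simp
  qed
  then show "b \<in> ?g ` ?R" using ij j by blast
next
  fix b assume "b \<in> ?g ` ?R"
  then obtain i where b: "b = (i, i + part mu i)" and i: "0 < part mu i"
    "Suc (part mu (Suc i)) < part mu i \<or> part mu (Suc i) = 0" by auto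
  obtain nu where "covers mu nu" "shifted_diagram nu = shifted_diagram mu - {b}"
    unfolding b by (rule remove_box[OF mu i])
  moreover have "1 \<le> i" using i by (cases i) auto
  then have "b \<in> shifted_diagram mu" using i by (simp add: b shifted_diagram_iff)
  ultimately show "b \<in> outer_corners mu" by (auto simp: outer_corners_def covers_def)
qed

lemma binom2_add_1: "binom2 (t + 1) = binom2 t + t"
proof -
  have "(t + 1) * (t + 1 - 1) = t * (t - 1) + t * 2" by (simp add: algebra_simps)
  then show ?thesis by (simp add: binom2_def)
qed

text \<open>With B = C(t,2) the difference is t (2 B + t), and 2 B + t = t^2. This is the source of
  the cubes in \<open>q2\<close>.\<close>

lemma binom2_square_diff: "(binom2 (t + 1))\<^sup>2 - (binom2 t)\<^sup>2 = t ^ 3"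
proof -
  have "2 * binom2 t = t * (t - 1)" by (simp add: binom2_def)
  moreover have "(binom2 (t + 1))\<^sup>2 - (binom2 t)\<^sup>2 = t * (2 * binom2 t) + t\<^sup>2"
    unfolding binom2_add_1 by (simp add: power2_eq_square algebra_simps)
  ultimately have "(binom2 (t + 1))\<^sup>2 - (binom2 t)\<^sup>2 = t * (t * (t - 1)) + t\<^sup>2" by simp
  then show ?thesis by (simp add: power2_eq_square power3_eq_cube algebra_simps)
qed

text \<open>To be read for a block of rows a < r <= b that all end in column \<open>B\<close>: their
  parts are B - r.\<close>

lemma sum_cubes_telescope:
  assumes "a \<le> b"
  shows "(\<Sum>r\<in>{a<..b}. (B - int r) ^ 3) = (binom2 (B - int a))\<^sup>2 - (binom2 (B - int b))\<^sup>2"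
  using assms
proof (induction b rule: dec_induct)
  case (step b)
  have "{a<..Suc b} = insert (Suc b) {a<..b}" using step.hyps by auto
  moreover have "B - int (Suc b) + 1 = B - int b" by simp
  ultimately show ?case using step.IH binom2_square_diff[of "B - int (Suc b)"] by simp
qed simp

text \<open>The second conjunct is carried through the induction because splitting the interval at
  \<open>al (Suc m)\<close> needs it.\<close>

lemma sum_consecutive_blocks:
  fixes al :: "nat \<Rightarrow> nat" and f :: "nat \<Rightarrow> 'a :: comm_monoid_add"
  assumes "\<And>k. 1 \<le> k \<Longrightarrow> k \<le> m \<Longrightarrow> al (Suc k) \<le> al k"
  shows "(\<Sum>k=1..m. \<Sum>r\<in>{al (Suc k)<..al k}. f r) = (\<Sum>r\<in>{al (Suc m)<..al 1}. f r) \<and> al (Suc m) \<le> al 1"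
  using assms
proof (induction m)
  case (Suc m)
  have le: "al (Suc (Suc m)) \<le> al (Suc m)" "al (Suc m) \<le> al 1" using Suc by simp_all
  then have "{al (Suc (Suc m))<..al 1} = {al (Suc m)<..al 1} \<union> {al (Suc (Suc m))<..al (Suc m)}" by auto
  moreover have "{al (Suc m)<..al 1} \<inter> {al (Suc (Suc m))<..al (Suc m)} = {}" by auto
  ultimately have "(\<Sum>r\<in>{al (Suc (Suc m))<..al 1}. f r)
     = (\<Sum>r\<in>{al (Suc m)<..al 1}. f r) + (\<Sum>r\<in>{al (Suc (Suc m))<..al (Suc m)}. f r)"
    by (simp add: sum.union_disjoint)
  then show ?case using Suc order_trans[OF le] by simp
qed simp

text \<open>The rows from just below one corner row down to the next corner row all end in the
  column of the latter. The cubes of their parts therefore telescope to the squares for x_k and y_k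
  at the two ends of the block.\<close>

lemma q2_conv_set:
  assumes mu: "strict_partition mu"
  shows "q2 mu = (\<Sum>a\<in>set mu. int a ^ 3)"
proof -
  let ?p = "part mu" and ?l = "length mu"
  define R where "R = {i. 0 < ?p i \<and> (Suc (?p (Suc i)) < ?p i \<or> ?p (Suc i) = 0)}"
  define g where "g i = (i, i + ?p i)" for i
  define rs where "rs = rev (sorted_list_of_set R)"
  define m where "m = length rs"
  let ?al = "corner_alpha mu" and ?be = "corner_beta mu"
  have RI: "R \<subseteq> {1..?l}" by (auto simp: R_def part_pos_iff[OF mu])
  then have finR: "finite R" by (rule finite_subset) simp
  have set_rs: "set rs = R" using finR by (simp add: rs_def)
  have cl: "corner_list mu = map g rs"
  proof -
    \<comment> \<open>\<open>g\<close> attaches the column to the row index, and corners lie in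
      distinct rows, so the lexicographic order is the order of rows.\<close>
    have "sorted_list_of_set (outer_corners mu) = map g (sorted_list_of_set R)"
    proof (rule sorted_distinct_set_unique)
      show "sorted (map g (sorted_list_of_set R))"
        unfolding sorted_map
        by (rule sorted_wrt_mono_rel[OF _ strict_sorted_list_of_set]) (auto simp: g_def less_eq_prod_def)
      show "distinct (map g (sorted_list_of_set R))"
        using finR by (auto simp: distinct_map g_def inj_on_def)
      show "set (sorted_list_of_set (outer_corners mu)) = set (map g (sorted_list_of_set R))"
        using finR outer_corners_conv[OF mu] by (simp add: R_def g_def)
    qed (use finR in simp_all)
    then show ?thesis by (simp add: corner_list_def rs_def rev_map)
  qed
  have len: "length (corner_list mu) = m" by (simp add: cl m_def)
  have al: "?al k = rs ! (k - 1)" if "1 \<le> k" "k \<le> m" for k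
    using that by (auto simp: corner_alpha_def cl m_def g_def)
  have al0: "?al (Suc m) = 0" by (simp add: corner_alpha_def len)
  have be: "?be k = ?al k + ?p (?al k)" if "1 \<le> k" "k \<le> m" for k
    using that by (auto simp: corner_alpha_def corner_beta_def cl m_def g_def)
  have alR: "?al k \<in> R" if "1 \<le> k" "k \<le> m" for k
    using that al[OF that] set_rs nth_mem[of "k - 1" rs] by (auto simp: m_def)
  have Ral: "\<exists>k. 1 \<le> k \<and> k \<le> m \<and> r = ?al k" if "r \<in> R" for r
  proof -
    obtain k where "k < m" "r = rs ! k" using \<open>r \<in> R\<close> set_rs by (auto simp: in_set_conv_nth m_def)
    then show ?thesis using al[of "Suc k"] by (intro exI[of _ "Suc k"]) auto
  qed
  have sorted: "sorted_wrt (>) rs"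
    unfolding rs_def sorted_wrt_rev by simp
  have less: "?al k' < ?al k" if "1 \<le> k" "k < k'" "k' \<le> m" for k k'
    using sorted_wrt_nth_less[OF sorted, of "k - 1" "k' - 1"] that al by (simp add: m_def)
  have anti: "?al k' \<le> ?al k" if "1 \<le> k" "k \<le> k'" for k k'
  proof (cases "k' \<le> m")
    case True
    then show ?thesis using less[of k k'] that by (cases "k = k'") auto
  qed (simp add: corner_alpha_def len)
  \<comment> \<open>The last row has nothing below it, so it always ends in a corner.\<close>
  have al1: "?al 1 = ?l"
  proof (cases "?l = 0")
    case True
    then have "m = 0" using RI set_rs by (simp add: m_def)
    then show ?thesis using al0 True by simp
  next
    case False
    then have "?l \<in> R" by (simp add: R_def part_pos_iff[OF mu] part_beyond Suc_le_eq)
    then obtain k where "1 \<le> k" "k \<le> m" "?l = ?al k" using Ral by blast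
    moreover then have "?al k \<le> ?al 1" using anti[of 1 k] by simp
    moreover have "?al 1 \<in> R" using alR[of 1] calculation by simp
    then have "?al 1 \<le> ?l" using RI by auto
    ultimately show ?thesis by simp
  qed
  \<comment> \<open>Going upwards from the corner row: a row without a corner is exactly one longer
    than the next, so it ends in the same column.\<close>
  have block: "r + ?p r = ?be k" if k: "1 \<le> k" "k \<le> m" and r: "?al (Suc k) < r" "r \<le> ?al k" for k r
    using r(2,1)
  proof (induction r rule: inc_induct)
    case base
    then show ?case using be[OF k] by simp
  next
    case (step r)
    have "r \<notin> R"
    proof
      assume "r \<in> R"
      then obtain k' where k': "1 \<le> k'" "k' \<le> m" "r = ?al k'" using Ral by blast
      then have "\<not> k' \<le> k" using anti[of k' k] step.hyps by auto
      then have "?al k' \<le> ?al (Suc k)" by (intro anti) auto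
      then show False using k' step.prems by simp
    qed
    moreover have "r \<le> ?l" using step.hyps alR[OF k] RI by auto
    then have "0 < ?p r" using step.prems by (simp add: part_pos_iff[OF mu])
    ultimately have "?p r = Suc (?p (Suc r))"
      using part_less[OF mu, of r "Suc r"] step.prems by (auto simp: R_def)
    then show ?case using step by simp
  qed
  \<comment> \<open>With the convention beta_0 = l + 1, the unpaired term i = 0 is C(1,2)^2 = 0; the
    remaining x_k pair off with the y_k.\<close>
  have x0: "corner_x mu 0 = 1" using al1 by (simp add: corner_x_def corner_beta_def)
  have "q2 mu = (\<Sum>k=1..m. (binom2 (corner_x mu k))\<^sup>2 - (binom2 (corner_y mu k))\<^sup>2)"
    unfolding q2_def len Let_def
    by (subst sum.atLeast_Suc_atMost) (simp_all add: sum_subtractf x0 binom2_def[of 1])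
  also have "\<dots> = (\<Sum>k=1..m. \<Sum>r\<in>{?al (Suc k)<..?al k}. int (?p r) ^ 3)"
  proof (rule sum.cong)
    fix k assume k: "k \<in> {1..m}"
    have "(binom2 (corner_x mu k))\<^sup>2 - (binom2 (corner_y mu k))\<^sup>2
        = (\<Sum>r\<in>{?al (Suc k)<..?al k}. (int (?be k) - int r) ^ 3)"
      using sum_cubes_telescope[of "?al (Suc k)" "?al k" "int (?be k)"] anti[of k "Suc k"] k
      by (simp add: corner_x_def corner_y_def)
    also have "\<dots> = (\<Sum>r\<in>{?al (Suc k)<..?al k}. int (?p r) ^ 3)"
    proof (rule sum.cong)
      fix r assume "r \<in> {?al (Suc k)<..?al k}"
      then have "r + ?p r = ?be k" using block[of k r] k by simp
      then have "int (?be k) - int r = int (?p r)" by linarith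
      then show "(int (?be k) - int r) ^ 3 = int (?p r) ^ 3" by simp
    qed simp
    finally show "(binom2 (corner_x mu k))\<^sup>2 - (binom2 (corner_y mu k))\<^sup>2
      = (\<Sum>r\<in>{?al (Suc k)<..?al k}. int (?p r) ^ 3)" .
  qed simp
  also have "\<dots> = (\<Sum>r\<in>{?al (Suc m)<..?al 1}. int (?p r) ^ 3)"
    by (rule conjunct1[OF sum_consecutive_blocks]) (rule anti, simp_all)
  also have "{?al (Suc m)<..?al 1} = {1..?l}" unfolding al0 al1 by auto
  also have "(\<Sum>r\<in>{1..?l}. int (?p r) ^ 3) = (\<Sum>a\<in>set mu. int a ^ 3)"
    by (rule sum.reindex_bij_betw[OF bij_betw_part[OF mu]])
  finally show ?thesis .
qed

section \<open>Hook products\<close>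

lemma hook_eq:
  assumes "(i, j) \<in> shifted_diagram lam"
  shows "hook lam (i, j) = (i + part lam i - j) + card {i'. (i', j) \<in> shifted_diagram lam \<and> i < i'} + 1 + part lam j"
proof -
  have "{j'. (i, j') \<in> shifted_diagram lam \<and> j < j'} = {j<..i + part lam i}"
    using assms by (auto simp: shifted_diagram_iff)
  then show ?thesis by (simp add: hook_def)
qed

text \<open>Rows i+1, ..., j-1 all reach column \<open>j\<close>, while row \<open>j\<close> starts
  only at column j+1. The leg thus has j-i-1 boxes and the positions cancel from arm + leg + 1 +
  \<open>part lam j\<close>.\<close>

lemma hook_left:
  assumes lam: "strict_partition lam" and ij: "1 \<le> i" "i < j" "j \<le> length lam"
  shows "hook lam (i, j) = part lam i + part lam j"
proof -
  have pos: "0 < part lam k" if "1 \<le> k" "k \<le> j" for k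
    using that ij part_pos_iff[OF lam, of k] by simp
  have le: "j < k + part lam k" if "1 \<le> k" "k \<le> j" for k
    using part_diff_le[OF lam that pos[of j]] ij pos[of j] by linarith
  have D: "(i, j) \<in> shifted_diagram lam" using ij le[of i] by (simp add: shifted_diagram_iff)
  have "{i'. (i', j) \<in> shifted_diagram lam \<and> i < i'} = {i<..<j}"
    using le ij by (auto simp: shifted_diagram_iff less_imp_le)
  then show ?thesis using hook_eq[OF D] le[of i] ij by simp
qed

text \<open>In row i the hook lengths in columns beyond \<open>length lam\<close> and the
  differences to the later parts partition {1, ..., \<open>part lam i\<close>}. The hooks decrease
  strictly along the row, avoid all differences, and their number i + p_i - l is the number of
  values left over.\<close>

lemma prod_hook_right:
  assumes lam: "strict_partition lam" and i: "1 \<le> i" "i \<le> length lam"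
  shows "(\<Prod>j\<in>{length lam<..i + part lam i}. hook lam (i, j)) * (\<Prod>j\<in>{i<..length lam}. part lam i - part lam j)
    = fact (part lam i)"
proof -
  let ?l = "length lam" and ?p = "part lam"
  let ?J = "{?l<..i + ?p i}" and ?S = "(\<lambda>s. ?p i - ?p s) ` {i<..?l}"
  define leg where "leg j = {i'. (i', j) \<in> shifted_diagram lam \<and> i < i'}" for j
  have pos: "0 < ?p k" if "1 \<le> k" "k \<le> ?l" for k
    using that by (simp add: part_pos_iff[OF lam])
  have shift: "t + ?p t \<le> s + ?p s" if "1 \<le> s" "s \<le> t" "t \<le> ?l" for s t
    using part_diff_le[OF lam that(1,2)] pos[of t] that by simp
  have pless: "?p s < ?p i" if "s \<in> {i<..?l}" for s
    using part_strict[OF lam i(1), of s] that by simp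
  have leg: "leg j = {i' \<in> {i<..?l}. j \<le> i' + ?p i'}" if "?l < j" for j
    using that by (auto simp: leg_def shifted_diagram_def)
  then have fin: "finite (leg j)" if "?l < j" for j using that by simp
  have h: "hook lam (i, j) = (i + ?p i - j) + card (leg j) + 1" if "j \<in> ?J" for j
  proof -
    have "(i, j) \<in> shifted_diagram lam" using that i by (simp add: shifted_diagram_iff)
    then show ?thesis using that by (simp add: hook_eq leg_def part_beyond)
  qed
  have inj: "inj_on (\<lambda>j. hook lam (i, j)) ?J"
  proof (rule linorder_inj_onI')
    fix j j' assume jj: "j \<in> ?J" "j' \<in> ?J" "j < j'"
    have "card (leg j') \<le> card (leg j)"
      using jj by (intro card_mono fin) (auto simp: leg)
    then have "hook lam (i, j') < hook lam (i, j)" using jj h by simp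
    then show "hook lam (i, j) \<noteq> hook lam (i, j')" by simp
  qed
  have into: "hook lam (i, j) \<in> {1..?p i} - ?S" if j: "j \<in> ?J" for j
  proof -
    have lj: "?l < j" "j \<le> i + ?p i" using j by auto
    have "card (leg j) \<le> card {i<..?l}"
      using lj by (intro card_mono) (auto simp: leg)
    then have le: "hook lam (i, j) \<le> ?p i" using h[OF j] lj i by simp
    \<comment> \<open>If row \<open>s\<close> reaches column \<open>j\<close>, the leg contains rows
      i+1, ..., s and the hook exceeds p_i - p_s; otherwise the leg stops before row
      \<open>s\<close> and the hook is smaller than p_i - p_s.\<close>
    have neS: "hook lam (i, j) \<noteq> ?p i - ?p s" if s: "s \<in> {i<..?l}" for s
    proof (cases "j \<le> s + ?p s")
      case True
      have "{i<..s} \<subseteq> leg j"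
      proof
        fix t assume "t \<in> {i<..s}"
        then show "t \<in> leg j" using True s shift[of t s] i by (simp add: leg[OF lj(1)])
      qed
      then have "s - i \<le> card (leg j)" using card_mono[OF fin[OF lj(1)], of "{i<..s}"] by simp
      then show ?thesis using h[OF j] s True pless[OF s] lj by simp
    next
      case False
      have "leg j \<subseteq> {i<..<s}"
      proof
        fix t assume t: "t \<in> leg j"
        then have "i < t" "t \<le> ?l" "j \<le> t + ?p t" using leg[OF lj(1)] by auto
        moreover then have "\<not> s \<le> t" using False s i shift[of s t] by auto
        ultimately show "t \<in> {i<..<s}" by simp
      qed
      then have "card (leg j) \<le> s - i - 1" using card_mono[of "{i<..<s}" "leg j"] by simp
      then show ?thesis using h[OF j] s False pless[OF s] lj by auto
    qed
    have "1 \<le> hook lam (i, j)" using h[OF j] by simp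
    moreover have "hook lam (i, j) \<notin> ?S"
    proof
      assume "hook lam (i, j) \<in> ?S"
      then obtain s where "s \<in> {i<..?l}" "hook lam (i, j) = ?p i - ?p s" by blast
      then show False using neS by blast
    qed
    ultimately show ?thesis using le by (simp only: Diff_iff atLeastAtMost_iff simp_thms)
  qed
  have injS: "inj_on (\<lambda>s. ?p i - ?p s) {i<..?l}"
  proof (rule inj_onI)
    fix s t assume st: "s \<in> {i<..?l}" "t \<in> {i<..?l}" "?p i - ?p s = ?p i - ?p t"
    have eq: "?p s = ?p t" using st(3) pless[OF st(1)] pless[OF st(2)] by linarith
    have "0 < ?p s" using pos[of s] st(1) i by simp
    with eq show "s = t" by (rule part_eq_pos[OF lam])
  qed
  have Ssub: "?S \<subseteq> {1..?p i}" using pless by (auto simp: Suc_le_eq)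
  have img: "(\<lambda>j. hook lam (i, j)) ` ?J = {1..?p i} - ?S"
  proof (rule card_subset_eq)
    show "(\<lambda>j. hook lam (i, j)) ` ?J \<subseteq> {1..?p i} - ?S" by (rule image_subsetI) (rule into)
    have "card ({1..?p i} - ?S) = ?p i - (?l - i)"
      using Ssub injS by (simp add: card_Diff_subset card_image)
    then show "card ((\<lambda>j. hook lam (i, j)) ` ?J) = card ({1..?p i} - ?S)"
      using i by (simp add: card_image[OF inj])
  qed simp
  have "(\<Prod>j\<in>?J. hook lam (i, j)) = \<Prod>({1..?p i} - ?S)"
    unfolding img[symmetric] by (simp add: prod.reindex[OF inj])
  moreover have "(\<Prod>j\<in>{i<..?l}. ?p i - ?p j) = \<Prod>?S"
    by (simp add: prod.reindex[OF injS])
  moreover have "\<Prod>({1..?p i} - ?S) * \<Prod>?S = \<Prod>{1..?p i}"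
    using Ssub by (intro prod.subset_diff[symmetric]) auto
  ultimately show ?thesis by (simp add: fact_prod)
qed

section \<open>The hook product as a function of the set of parts\<close>

definition hook_weight :: "nat set \<Rightarrow> real" where
  "hook_weight A = (\<Prod>a\<in>A. fact a * (\<Prod>b\<in>{b\<in>A. b < a}. (real a + real b) / (real a - real b)))"

text \<open>The columns up to \<open>length lam\<close> give the sums p_i + p_j, the columns beyond
  give the factorial over the differences p_i - p_j; the indices j > i enumerate the smaller
  parts.\<close>

lemma prod_hook_row:
  assumes lam: "strict_partition lam" and i: "1 \<le> i" "i \<le> length lam"
  shows "real (\<Prod>j\<in>{i<..i + part lam i}. hook lam (i, j))
    = fact (part lam i) * (\<Prod>b\<in>{b\<in>set lam. b < part lam i}.
        (real (part lam i) + real b) / (real (part lam i) - real b))"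
proof -
  let ?l = "length lam" and ?p = "part lam"
  have pos: "0 < ?p k" if "1 \<le> k" "k \<le> ?l" for k
    using that by (simp add: part_pos_iff[OF lam])
  have pless: "?p s < ?p i" if "s \<in> {i<..?l}" for s
    using part_strict[OF lam i(1), of s] that by simp
  have li: "?l \<le> i + ?p i" using part_diff_le[OF lam i] pos[of ?l] i by simp
  have bij: "bij_betw ?p {i<..?l} {b\<in>set lam. b < ?p i}"
    unfolding bij_betw_def
  proof (intro conjI equalityI subsetI)
    show "inj_on ?p {i<..?l}" using inj_on_part[OF lam] by (rule inj_on_subset) (use i in auto)
    fix b assume "b \<in> ?p ` {i<..?l}"
    then obtain s where s: "s \<in> {i<..?l}" "b = ?p s" by blast
    then have "b \<in> set lam" using i by (auto simp: set_conv_part)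
    then show "b \<in> {b\<in>set lam. b < ?p i}" using pless[OF s(1)] s(2) by simp
  next
    fix b assume "b \<in> {b\<in>set lam. b < ?p i}"
    then obtain k where k: "b = ?p k" "1 \<le> k" "k \<le> ?l" "?p k < ?p i" by (auto simp: set_conv_part)
    then have "\<not> k \<le> i" using part_strict[OF lam k(2), of i] i by (cases "k = i") auto
    then show "b \<in> ?p ` {i<..?l}" using k by auto
  qed
  have "{i<..i + ?p i} = {i<..?l} \<union> {?l<..i + ?p i}" using li i by auto
  then have "(\<Prod>j\<in>{i<..i + ?p i}. hook lam (i, j))
      = (\<Prod>j\<in>{i<..?l}. hook lam (i, j)) * (\<Prod>j\<in>{?l<..i + ?p i}. hook lam (i, j))"
    by (simp add: prod.union_disjoint)
  also have "(\<Prod>j\<in>{i<..?l}. hook lam (i, j)) = (\<Prod>j\<in>{i<..?l}. ?p i + ?p j)"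
    using hook_left[OF lam i(1)] by (intro prod.cong) auto
  finally have eq: "real (\<Prod>j\<in>{i<..i + ?p i}. hook lam (i, j))
      = (\<Prod>j\<in>{i<..?l}. real (?p i) + real (?p j)) * real (\<Prod>j\<in>{?l<..i + ?p i}. hook lam (i, j))"
    by simp
  have sub: "real (\<Prod>j\<in>{i<..?l}. ?p i - ?p j) = (\<Prod>j\<in>{i<..?l}. real (?p i) - real (?p j))"
    unfolding of_nat_prod using pless by (intro prod.cong) (auto simp: of_nat_diff less_imp_le)
  have ne: "(\<Prod>j\<in>{i<..?l}. real (?p i) - real (?p j)) \<noteq> 0"
  proof -
    have "real (?p i) - real (?p j) \<noteq> 0" if "j \<in> {i<..?l}" for j using pless[OF that] by simp
    then show ?thesis unfolding prod_zero_iff[OF finite_greaterThanAtMost] by blast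
  qed
  have "real (\<Prod>j\<in>{?l<..i + ?p i}. hook lam (i, j)) * (\<Prod>j\<in>{i<..?l}. real (?p i) - real (?p j)) = fact (?p i)"
    using arg_cong[OF prod_hook_right[OF lam i], of real] unfolding of_nat_mult sub by simp
  then have "real (\<Prod>j\<in>{?l<..i + ?p i}. hook lam (i, j))
      = fact (?p i) / (\<Prod>j\<in>{i<..?l}. real (?p i) - real (?p j))"
    using ne by (simp add: eq_divide_eq)
  then have "real (\<Prod>j\<in>{i<..i + ?p i}. hook lam (i, j))
      = fact (?p i) * (\<Prod>j\<in>{i<..?l}. (real (?p i) + real (?p j)) / (real (?p i) - real (?p j)))"
    using eq by (simp add: prod_dividef)
  also have "(\<Prod>j\<in>{i<..?l}. (real (?p i) + real (?p j)) / (real (?p i) - real (?p j)))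
    = (\<Prod>b\<in>{b\<in>set lam. b < ?p i}. (real (?p i) + real b) / (real (?p i) - real b))"
    by (rule prod.reindex_bij_betw[OF bij])
  finally show ?thesis .
qed

lemma hook_product_conv_set:
  assumes "strict_partition lam"
  shows "real (hook_product lam) = hook_weight (set lam)"
proof -
  have "hook_product lam = (\<Prod>i\<in>{1..length lam}. \<Prod>j\<in>{i<..i + part lam i}. hook lam (i, j))"
    unfolding hook_product_def shifted_diagram_Sigma by (subst prod.Sigma) auto
  then have "real (hook_product lam) = (\<Prod>i\<in>{1..length lam}. real (\<Prod>j\<in>{i<..i + part lam i}. hook lam (i, j)))"
    by simp
  also have "\<dots> = (\<Prod>i\<in>{1..length lam}. fact (part lam i) * (\<Prod>b\<in>{b\<in>set lam. b < part lam i}.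
        (real (part lam i) + real b) / (real (part lam i) - real b)))"
    by (intro prod.cong refl prod_hook_row[OF assms]) auto
  also have "\<dots> = hook_weight (set lam)"
    unfolding hook_weight_def by (rule prod.reindex_bij_betw[OF bij_betw_part[OF assms]])
  finally show ?thesis .
qed

text \<open>Each pair {c, b} occurs once in the double product, with the smaller part subtracted
  from the larger. The absolute value merges the two cases.\<close>

lemma hook_weight_insert:
  assumes fin: "finite B" and c: "c \<notin> B"
  shows "hook_weight (insert c B)
    = hook_weight B * (fact c * (\<Prod>b\<in>B. (real c + real b) / \<bar>real c - real b\<bar>))"
proof -
  let ?q = "\<lambda>a b. (real a + real b) / (real a - real b)"
  let ?r = "\<lambda>b. (real c + real b) / \<bar>real c - real b\<bar>"
  have 1: "(\<Prod>b\<in>{b\<in>insert c B. b < a}. ?q a b)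
      = (if c < a then ?r a else 1) * (\<Prod>b\<in>{b\<in>B. b < a}. ?q a b)" if "a \<in> B" for a
  proof (cases "c < a")
    case True
    then have "{b\<in>insert c B. b < a} = insert c {b\<in>B. b < a}" by auto
    then show ?thesis using True c fin by (simp add: add.commute)
  next
    case False
    then have "{b\<in>insert c B. b < a} = {b\<in>B. b < a}" by auto
    then show ?thesis using False by simp
  qed
  have "{b\<in>insert c B. b < c} = {b\<in>B. b < c}" by auto
  then have 2: "(\<Prod>b\<in>{b\<in>insert c B. b < c}. ?q c b) = (\<Prod>b\<in>B. if b < c then ?r b else 1)"
    using fin by (simp add: prod.If_cases Int_def conj_commute)
  have 3: "(\<Prod>a\<in>B. fact a * (\<Prod>b\<in>{b\<in>insert c B. b < a}. ?q a b))
      = (\<Prod>a\<in>B. fact a * ((if c < a then ?r a else 1) * (\<Prod>b\<in>{b\<in>B. b < a}. ?q a b)))"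
    by (rule prod.cong) (simp_all only: 1)
  have "hook_weight (insert c B) = fact c * (\<Prod>b\<in>B. if b < c then ?r b else 1) *
      (\<Prod>a\<in>B. fact a * ((if c < a then ?r a else 1) * (\<Prod>b\<in>{b\<in>B. b < a}. ?q a b)))"
    unfolding hook_weight_def prod.insert[OF fin c] 2 3 ..
  also have "\<dots> = fact c * ((\<Prod>b\<in>B. if b < c then ?r b else 1) * (\<Prod>a\<in>B. if c < a then ?r a else 1))
      * hook_weight B"
    by (simp add: hook_weight_def prod.distrib mult_ac)
  also have "(\<Prod>b\<in>B. if b < c then ?r b else 1) * (\<Prod>a\<in>B. if c < a then ?r a else 1) = (\<Prod>b\<in>B. ?r b)"
    unfolding prod.distrib[symmetric] using c by (intro prod.cong) auto
  finally show ?thesis by (simp add: mult_ac)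
qed

lemma hook_weight_nonzero: "finite A \<Longrightarrow> 0 \<notin> A \<Longrightarrow> hook_weight A \<noteq> 0"
  by (induction A rule: finite_induct) (auto simp: hook_weight_insert, auto simp: hook_weight_def)

section \<open>Transition weights and averages over levels\<close>

definition levels :: "nat list \<Rightarrow> nat \<Rightarrow> nat list set" where
  "levels mu n = {lam. strict_partition lam \<and> contains lam mu \<and> psize lam = psize mu + n}"

lemma covers_strict: "covers lam nu \<Longrightarrow> strict_partition lam \<and> strict_partition nu"
  by (simp add: covers_def)

lemma finite_levels: "finite (levels mu n)"
  by (rule finite_subset[OF _ finite_strict_partitions[of "psize mu + n"]]) (auto simp: levels_def)

lemma levels_0: "strict_partition mu \<Longrightarrow> levels mu 0 = {mu}"
  using contains_psize_eq by (auto simp: levels_def contains_def)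

text \<open>After the recursion for tableaux is inserted, the sums over covering pairs are
  exchanged; every partition covering a member of level n already contains
  \<open>mu\<close>.\<close>

lemma sum_levels_Suc:
  fixes f :: "nat list \<Rightarrow> real"
  assumes mu: "strict_partition mu"
  shows "(\<Sum>lam\<in>levels mu (Suc n). real (num_syt lam mu) * f lam)
    = (\<Sum>nu\<in>levels mu n. real (num_syt nu mu) * (\<Sum>lam | covers lam nu. f lam))"
proof -
  have down: "{nu. covers lam nu \<and> contains nu mu} = {nu \<in> levels mu n. covers lam nu}"
    if "lam \<in> levels mu (Suc n)" for lam
    using that by (auto simp: levels_def dest: covers_psize covers_strict)
  have up: "{lam \<in> levels mu (Suc n). covers lam nu} = {lam. covers lam nu}"
    if "nu \<in> levels mu n" for nu
  proof -
    have "contains lam mu" if "covers lam nu" for lam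
      using covers_contains[OF that] \<open>nu \<in> levels mu n\<close> by (auto simp: levels_def contains_def intro: order_trans)
    then show ?thesis using that by (auto simp: levels_def dest: covers_psize covers_strict)
  qed
  have "(\<Sum>lam\<in>levels mu (Suc n). real (num_syt lam mu) * f lam)
      = (\<Sum>lam\<in>levels mu (Suc n). \<Sum>nu\<in>{nu \<in> levels mu n. covers lam nu}. real (num_syt nu mu) * f lam)"
  proof (rule sum.cong)
    fix lam assume lam: "lam \<in> levels mu (Suc n)"
    then have "num_syt lam mu = (\<Sum>nu | covers lam nu \<and> contains nu mu. num_syt nu mu)"
      by (intro num_syt_rec[OF _ mu]) (auto simp: levels_def)
    then show "real (num_syt lam mu) * f lam
      = (\<Sum>nu\<in>{nu \<in> levels mu n. covers lam nu}. real (num_syt nu mu) * f lam)"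
      using down[OF lam] by (simp add: sum_distrib_right)
  qed simp
  also have "\<dots> = (\<Sum>nu\<in>levels mu n. \<Sum>lam\<in>{lam \<in> levels mu (Suc n). covers lam nu}. real (num_syt nu mu) * f lam)"
    by (rule sum.swap_restrict[OF finite_levels finite_levels])
  also have "\<dots> = (\<Sum>nu\<in>levels mu n. real (num_syt nu mu) * (\<Sum>lam | covers lam nu. f lam))"
    by (rule sum.cong) (simp_all add: up sum_distrib_left)
  finally show ?thesis .
qed

section \<open>Triangular numbers as poles and zeros, and the transition weights\<close>

definition tri :: "nat \<Rightarrow> real" where
  "tri a = real a * (real a + 1) / 2"

definition tri' :: "nat \<Rightarrow> real" where
  "tri' a = real a * (real a - 1) / 2"

lemma tri_0 [simp]: "tri 0 = 0"
  by (simp add: tri_def)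

lemma tri'_Suc: "tri' (Suc a) = tri a"
  by (simp add: tri_def tri'_def)

lemma tri_diff_tri': "tri a - tri' b = (real a + real b) * (real a + 1 - real b) / 2"
  by (simp add: tri_def tri'_def field_simps)

lemma tri_diff_tri'_same: "tri a - tri' a = real a"
  by (simp add: tri_diff_tri')

lemma tri_diff: "tri a - tri b = (real a - real b) * (real a + 1 + real b) / 2"
  by (simp add: tri_def field_simps)

lemma inj_tri: "inj_on tri A"
proof (rule inj_onI)
  fix a b assume "tri a = tri b"
  then have "(real a - real b) * (real a + 1 + real b) = 0" using tri_diff[of a b] by simp
  moreover have "real a + 1 + real b \<noteq> 0" by linarith
  ultimately show "a = b" by simp
qed

abbreviation transition :: "nat set \<Rightarrow> nat \<Rightarrow> real" where
  "transition \<equiv> residue_weight tri tri' 0"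

text \<open>The zero Y_(a+1) coincides with the pole position X_a, so the numerator
  vanishes.\<close>

lemma transition_eq_0: "finite A \<Longrightarrow> Suc a \<in> A \<Longrightarrow> transition A a = 0"
  by (auto simp: residue_weight_def prod_zero_iff tri'_Suc intro!: bexI[of _ "Suc a"])

text \<open>The summand of the theorem is the tableau count times the quotient of the values at
  \<open>lam\<close> and \<open>mu\<close>, times the content difference.\<close>

definition path_weight :: "nat set \<Rightarrow> real" where
  "path_weight A = 2 powi (int (\<Sum>A) - int (card A)) / hook_weight A"

text \<open>For a = 0 size and length both grow, so the power of 2 is unchanged. For a > 0 it
  doubles, and with a!/(a+1)! this gives 2/(a+1), the factor of the transition weight coming from
  the zero Y_a and the pole X_0.\<close>

lemma path_weight_add_box:
  assumes fin: "finite A" and A0: "0 \<notin> A" and a: "a \<in> insert 0 A" "Suc a \<notin> A"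
  shows "path_weight (insert (Suc a) (A - {a})) = path_weight A * transition A a"
proof (cases "a = 0")
  case True
  have "A - {a} = A" using True A0 by simp
  then have hw: "hook_weight (insert (Suc a) (A - {a}))
      = hook_weight A * (\<Prod>b\<in>A. (1 + real b) / \<bar>1 - real b\<bar>)"
    using hook_weight_insert[OF fin, of "Suc 0"] a True by simp
  have "transition A a = (\<Prod>b\<in>A. tri' b / tri b)"
    using A0 True by (simp add: residue_weight_def prod_uminus prod_dividef)
  also have "\<dots> = (\<Prod>b\<in>A. inverse ((1 + real b) / \<bar>1 - real b\<bar>))"
  proof (rule prod.cong)
    fix b assume "b \<in> A"
    then have "b \<noteq> 0" "b \<noteq> 1" using A0 a(2) True by (metis, metis One_nat_def)
    then have "2 \<le> b" by simp
    then show "tri' b / tri b = inverse ((1 + real b) / \<bar>1 - real b\<bar>)"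
      by (simp add: tri_def tri'_def divide_simps)
  qed simp
  finally have tr: "transition A a = inverse (\<Prod>b\<in>A. (1 + real b) / \<bar>1 - real b\<bar>)"
    by (simp only: prod_inversef[symmetric] comp_def)
  have "int (\<Sum>(insert (Suc a) (A - {a}))) - int (card (insert (Suc a) (A - {a}))) = int (\<Sum>A) - int (card A)"
    using fin a True A0 by simp
  then show ?thesis unfolding path_weight_def hw tr by (simp add: divide_inverse)
next
  case False
  define B where "B = A - {a}"
  have B: "A = insert a B" "a \<notin> B" "finite B" "Suc a \<notin> B" "0 \<notin> B" "0 < a"
    using a False fin A0 by (auto simp: B_def)
  \<comment> \<open>\<open>P\<close> and \<open>Q\<close> collect the hook factors pairing the other
    parts with a and with a+1; \<open>S\<close> is their share of the transition weight.\<close>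
  define P where "P = (\<Prod>b\<in>B. (real a + real b) / \<bar>real a - real b\<bar>)"
  define Q where "Q = (\<Prod>b\<in>B. (real (Suc a) + real b) / \<bar>real (Suc a) - real b\<bar>)"
  define S where "S = (\<Prod>b\<in>B. (tri a - tri' b) / (tri a - tri b))"
  have PQ: "P = Q * S"
    unfolding P_def Q_def S_def prod.distrib[symmetric]
  proof (rule prod.cong)
    fix b assume "b \<in> B"
    then have "b \<noteq> a" "b \<noteq> Suc a" using B by auto
    then have b: "real a - real b \<noteq> 0" "real a + 1 - real b \<noteq> 0" "real a + 1 + real b \<noteq> 0"
      by auto
    \<comment> \<open>\<open>b\<close> is neither a nor a+1, so a - b and a+1 - b have a common sign
      \<open>s\<close>, which cancels.\<close>
    obtain s where s: "s \<noteq> 0" "\<bar>real a - real b\<bar> = s * (real a - real b)"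
      "\<bar>real (Suc a) - real b\<bar> = s * (real a + 1 - real b)"
    proof (cases "a < b")
      case True
      then show ?thesis using that[of "-1"] \<open>b \<noteq> Suc a\<close> by simp
    next
      case False
      then show ?thesis using that[of 1] by simp
    qed
    show "(real a + real b) / \<bar>real a - real b\<bar>
        = (real (Suc a) + real b) / \<bar>real (Suc a) - real b\<bar> * ((tri a - tri' b) / (tri a - tri b))"
      unfolding tri_diff tri_diff_tri' s(2,3) using b s(1) by (simp add: divide_simps)
  qed simp
  have "P \<noteq> 0" unfolding P_def using B by auto
  then have QS: "Q \<noteq> 0" "S \<noteq> 0" using PQ by auto
  have "insert 0 A - {a} = insert 0 B" using B by auto
  then have "transition A a = real a / tri a * S"
    using B by (simp add: residue_weight_def S_def prod_dividef tri_diff_tri'_same)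
  also have "real a / tri a = 2 / real (Suc a)" using B(6) by (simp add: tri_def divide_simps)
  finally have tr: "transition A a = 2 / real (Suc a) * S" .
  have e: "int (\<Sum>(insert (Suc a) B)) - int (card (insert (Suc a) B)) = int (\<Sum>A) - int (card A) + 1"
    using B by simp
  have hA: "hook_weight A = hook_weight B * (fact a * P)"
    using hook_weight_insert[OF B(3,2)] by (simp add: B(1) P_def)
  have hn: "hook_weight (insert (Suc a) B) = hook_weight B * (fact (Suc a) * Q)"
    using hook_weight_insert[OF B(3,4)] by (simp add: Q_def)
  show ?thesis
    unfolding path_weight_def B_def[symmetric] e hA hn tr PQ
    using QS hook_weight_nonzero[OF B(3,5)]
    by (simp add: power_int_add divide_simps)
qed

lemma path_weight_nonzero: "finite A \<Longrightarrow> 0 \<notin> A \<Longrightarrow> path_weight A \<noteq> 0"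
  by (simp add: path_weight_def hook_weight_nonzero)

text \<open>The mean of \<open>F\<close> after one random box. Where the box cannot be added, the
  argument of \<open>F\<close> is a set that has lost the part \<open>a\<close>, but there the
  weight is 0.\<close>

definition transfer :: "(nat set \<Rightarrow> real) \<Rightarrow> nat set \<Rightarrow> real" where
  "transfer F A = (\<Sum>a\<in>insert 0 A. transition A a * F (insert (Suc a) (A - {a})))"

lemma sum_covers_path_weight:
  assumes nu: "strict_partition nu"
  shows "(\<Sum>lam | covers lam nu. path_weight (set lam) * F (set lam))
    = path_weight (set nu) * transfer F (set nu)"
proof -
  let ?A = "set nu"
  have A0: "0 \<notin> ?A" using nu by (auto simp: strict_partition_def)
  have "(\<Sum>lam | covers lam nu. path_weight (set lam) * F (set lam))
    = (\<Sum>a\<in>{a \<in> insert 0 ?A. Suc a \<notin> ?A}.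
        path_weight (insert (Suc a) (?A - {a})) * F (insert (Suc a) (?A - {a})))"
    by (rule sum_covers[OF nu, of "\<lambda>S. path_weight S * F S"])
  also have "\<dots> = (\<Sum>a\<in>{a \<in> insert 0 ?A. Suc a \<notin> ?A}.
        path_weight ?A * (transition ?A a * F (insert (Suc a) (?A - {a}))))"
    by (rule sum.cong) (use path_weight_add_box[OF _ A0] in auto)
  also have "\<dots> = (\<Sum>a\<in>insert 0 ?A.
        path_weight ?A * (transition ?A a * F (insert (Suc a) (?A - {a}))))"
    by (rule sum.mono_neutral_left) (auto simp: transition_eq_0)
  finally show ?thesis by (simp only: transfer_def sum_distrib_left)
qed

lemma transition_moments:
  assumes "finite A" "0 \<notin> A"
  shows "(\<Sum>a\<in>insert 0 A. transition A a) = 1"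
    and "(\<Sum>a\<in>insert 0 A. transition A a * tri a) = real (\<Sum>A)"
    and "(\<Sum>a\<in>insert 0 A. transition A a * (tri a)\<^sup>2) = ((real (\<Sum>A))\<^sup>2 + (\<Sum>a\<in>A. real a ^ 3)) / 2"
proof -
  note m = residue_weight_moments[OF assms inj_tri tri_0, of tri']
  \<comment> \<open>X_j - Y_j = j and X_j + Y_j = j^2.\<close>
  have "(tri j)\<^sup>2 - (tri' j)\<^sup>2 = real j ^ 3" for j
    by (simp add: tri_def tri'_def power2_eq_square power3_eq_cube field_simps)
  then show "(\<Sum>a\<in>insert 0 A. transition A a) = 1"
    and "(\<Sum>a\<in>insert 0 A. transition A a * tri a) = real (\<Sum>A)"
    and "(\<Sum>a\<in>insert 0 A. transition A a * (tri a)\<^sup>2) = ((real (\<Sum>A))\<^sup>2 + (\<Sum>a\<in>A. real a ^ 3)) / 2"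
    using m by (simp_all only: tri_diff_tri'_same of_nat_sum)
qed

text \<open>A new box changes \<open>sum f\<close> by \<open>f (Suc a) - f a\<close>, so a quadratic
  in X_a needs only the first three moments. The condition \<open>f 0 = 0\<close> makes this valid
  also for a new row, where no part is removed.\<close>

lemma transfer_additive:
  assumes fin: "finite A" and A0: "0 \<notin> A" and f0: "f 0 = 0"
    and step: "\<And>a. f (Suc a) - f a = c2 * (tri a)\<^sup>2 + c1 * tri a + c0"
  shows "transfer (sum f) A = sum f A + c2 * (((real (\<Sum>A))\<^sup>2 + (\<Sum>a\<in>A. real a ^ 3)) / 2)
    + c1 * real (\<Sum>A) + c0"
proof -
  have "transition A a * sum f (insert (Suc a) (A - {a}))
      = sum f A * transition A a + c2 * (transition A a * (tri a)\<^sup>2)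
        + c1 * (transition A a * tri a) + c0 * transition A a" if a: "a \<in> insert 0 A" for a
  proof (cases "Suc a \<in> A")
    case True
    then show ?thesis using transition_eq_0[OF fin] by simp
  next
    case False
    have "sum f (insert (Suc a) (A - {a})) = f (Suc a) + sum f (A - {a})" using False fin by simp
    moreover have "sum f A = f a + sum f (A - {a})"
      using a A0 f0 fin by (cases "a \<in> A") (auto simp: sum.remove)
    ultimately have "sum f (insert (Suc a) (A - {a})) = sum f A + (f (Suc a) - f a)" by simp
    then show ?thesis unfolding step by (simp add: algebra_simps)
  qed
  then have "transfer (sum f) A = (\<Sum>a\<in>insert 0 A. sum f A * transition A a + c2 * (transition A a * (tri a)\<^sup>2)
        + c1 * (transition A a * tri a) + c0 * transition A a)"
    unfolding transfer_def by (rule sum.cong[OF refl])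
  then show ?thesis
    by (simp only: sum.distrib sum_distrib_left[symmetric] transition_moments[OF fin A0] mult_1_right)
qed

lemma real_choose_2: "real (n choose 2) = real n * (real n - 1) / 2"
  by (induction n) (auto simp: numeral_2_eq_2 field_simps)

lemma real_choose_3: "real (n choose 3) = real n * (real n - 1) * (real n - 2) / 6"
proof (induction n)
  case (Suc n)
  have "Suc n choose 3 = (n choose 2) + (n choose 3)" by (simp add: eval_nat_numeral)
  then show ?case using Suc real_choose_2[of n] by (simp add: field_simps)
qed simp

lemma real_choose_4: "real (n choose 4) = real n * (real n - 1) * (real n - 2) * (real n - 3) / 24"
proof (induction n)
  case (Suc n)
  have "Suc n choose 4 = (n choose 3) + (n choose 4)" by (simp add: eval_nat_numeral)
  then show ?case using Suc real_choose_3[of n] by (simp add: field_simps)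
qed simp

definition content_sum :: "nat \<Rightarrow> real" where
  "content_sum a = real ((a + 2) choose 5)"

text \<open>24 C(a+2,4) = a(a+1) * (a-1)(a+2), and the two products are 2 X_a and 2 X_a - 2.\<close>

lemma content_sum_Suc: "content_sum (Suc a) - content_sum a = 1/6 * (tri a)\<^sup>2 + (- 1/6) * tri a + 0"
proof -
  have "content_sum (Suc a) - content_sum a = real ((a + 2) choose 4)"
    by (simp only: content_sum_def choose_5_Suc of_nat_add add_diff_cancel_left')
  then show ?thesis
    by (simp add: real_choose_4 tri_def power2_eq_square field_simps)
qed

text \<open>The 1/12 of the theorem is this 1/6 times the 1/2 in the second moment.\<close>

lemma transfer_content_sum:
  assumes "finite A" "0 \<notin> A"
  shows "transfer (sum content_sum) A = sum content_sum A
    + 1/12 * ((\<Sum>a\<in>A. real a ^ 3) + (real (\<Sum>A))\<^sup>2 - 2 * real (\<Sum>A))"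
proof -
  have "content_sum 0 = 0" by (simp add: content_sum_def)
  then show ?thesis
    using transfer_additive[OF assms _ content_sum_Suc] by (simp add: field_simps)
qed

lemma transfer_cubes:
  assumes "finite A" "0 \<notin> A"
  shows "transfer (sum (\<lambda>a. real a ^ 3)) A = (\<Sum>a\<in>A. real a ^ 3) + 6 * real (\<Sum>A) + 1"
proof -
  have "real (Suc a) ^ 3 - real a ^ 3 = 0 * (tri a)\<^sup>2 + 6 * tri a + 1" for a
    by (simp add: tri_def power3_eq_cube field_simps)
  from transfer_additive[OF assms _ this] show ?thesis by simp
qed

lemma transfer_const:
  assumes "finite A" "0 \<notin> A"
  shows "transfer (\<lambda>_. c) A = c"
  using transition_moments(1)[OF assms] by (simp add: transfer_def sum_distrib_right[symmetric])

section \<open>Averages over the partitions n boxes above \<open>mu\<close>\<close>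

definition level_sum :: "nat list \<Rightarrow> nat \<Rightarrow> (nat set \<Rightarrow> real) \<Rightarrow> real" where
  "level_sum mu n F = (\<Sum>lam\<in>levels mu n. real (num_syt lam mu) * (path_weight (set lam) * F (set lam)))"

lemma level_sum_0: "strict_partition mu \<Longrightarrow> level_sum mu 0 F = path_weight (set mu) * F (set mu)"
  by (simp add: level_sum_def levels_0)

text \<open>\<open>G\<close> is compared with \<open>transfer F\<close> only on sets of the size of
  level n, so terms in the size become constants there.\<close>

lemma level_sum_Suc:
  assumes mu: "strict_partition mu"
    and G: "\<And>A. finite A \<Longrightarrow> 0 \<notin> A \<Longrightarrow> \<Sum>A = psize mu + n \<Longrightarrow> transfer F A = G A"
  shows "level_sum mu (Suc n) F = level_sum mu n G"
  unfolding level_sum_def sum_levels_Suc[OF mu]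
proof (rule sum.cong)
  fix nu assume nu: "nu \<in> levels mu n"
  then have s: "strict_partition nu" by (simp add: levels_def)
  have "\<Sum>(set nu) = psize mu + n" using nu psize_conv_set[OF s] by (simp add: levels_def)
  then have "transfer F (set nu) = G (set nu)"
    using s by (intro G) (auto simp: strict_partition_def)
  then show "real (num_syt nu mu) * (\<Sum>lam | covers lam nu. path_weight (set lam) * F (set lam))
      = real (num_syt nu mu) * (path_weight (set nu) * G (set nu))"
    using sum_covers_path_weight[OF s, of F] by simp
qed simp

lemma level_sum_const: "strict_partition mu \<Longrightarrow> level_sum mu n (\<lambda>_. c) = path_weight (set mu) * c"
  by (induction n) (simp_all add: level_sum_0 level_sum_Suc[of _ _ _ "\<lambda>_. c"] transfer_const)

lemma level_sum_add: "level_sum mu n (\<lambda>A. F A + G A) = level_sum mu n F + level_sum mu n G"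
  by (simp add: level_sum_def sum.distrib algebra_simps)

lemma level_sum_mult: "level_sum mu n (\<lambda>A. c * F A) = c * level_sum mu n F"
  by (simp add: level_sum_def sum_distrib_left mult_ac)

text \<open>Summing the increments 6 (|mu| + k) + 1 over k < n.\<close>

lemma level_sum_cubes:
  assumes mu: "strict_partition mu"
  shows "level_sum mu n (sum (\<lambda>a. real a ^ 3)) = path_weight (set mu) *
    ((\<Sum>a\<in>set mu. real a ^ 3) + 6 * real (psize mu) * real n + 3 * real n * (real n - 1) + real n)"
proof (induction n)
  case 0
  show ?case by (simp add: level_sum_0[OF mu])
next
  case (Suc n)
  have "level_sum mu (Suc n) (sum (\<lambda>a. real a ^ 3))
      = level_sum mu n (\<lambda>A. sum (\<lambda>a. real a ^ 3) A + (6 * real (psize mu + n) + 1))"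
    by (rule level_sum_Suc[OF mu]) (simp add: transfer_cubes)
  then show ?case
    by (simp add: level_sum_add level_sum_const[OF mu] Suc algebra_simps)
qed

lemma level_sum_content_sum:
  assumes mu: "strict_partition mu"
  shows "level_sum mu n (sum content_sum) = path_weight (set mu) * (sum content_sum (set mu)
     + 2/3 * real (n choose 3) + 2/3 * real (psize mu) * real (n choose 2)
     + 1/12 * ((\<Sum>a\<in>set mu. real a ^ 3) + (real (psize mu))\<^sup>2 - 2 * real (psize mu)) * real n)"
proof (induction n)
  case 0
  show ?case by (simp add: level_sum_0[OF mu] real_choose_2 real_choose_3)
next
  case (Suc n)
  have "level_sum mu (Suc n) (sum content_sum)
      = level_sum mu n (\<lambda>A. sum content_sum A + 1/12 * (sum (\<lambda>a. real a ^ 3) A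
          + ((real (psize mu + n))\<^sup>2 - 2 * real (psize mu + n))))"
    by (rule level_sum_Suc[OF mu]) (simp add: transfer_content_sum)
  also have "\<dots> = level_sum mu n (sum content_sum) + 1/12 * (level_sum mu n (sum (\<lambda>a. real a ^ 3))
          + path_weight (set mu) * ((real (psize mu + n))\<^sup>2 - 2 * real (psize mu + n)))"
    by (simp only: level_sum_add level_sum_mult level_sum_const[OF mu])
  finally show ?case
    \<comment> \<open>In the increment the |mu| n terms add up to (6 + 2)/12 = 2/3, and the terms in
      n alone to (4 n^2 - 4 n)/12 = 2/3 C(n,2); these are the differences of the binomials in the
      claim.\<close>
    by (simp only: Suc level_sum_cubes[OF mu] real_choose_3 real_choose_2)
      (simp add: power2_eq_square field_simps)
qed

theorem theorem4p3:
  fixes mu :: "nat list" and n :: nat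
  assumes "strict_partition mu"
  shows "(\<Sum>lam \<in> {lam. strict_partition lam \<and> contains lam mu \<and> psize lam = psize mu + n}.
            (2::real) powi (int (psize lam) - int (length lam) - int (psize mu) + int (length mu))
            * real (num_syt lam mu) * real (hook_product mu) / real (hook_product lam)
            * ((\<Sum>b\<in>shifted_diagram lam. content_binom4 b) - (\<Sum>b\<in>shifted_diagram mu. content_binom4 b)))
         = 2/3 * real (n choose 3) + 2/3 * real (psize mu) * real (n choose 2)
           + 1/12 * (real_of_int (q2 mu) + real (psize mu)^2 - 2 * real (psize mu)) * real n"
proof -
  let ?W = "path_weight (set mu)" and ?g = "sum content_sum"
  have pw: "path_weight (set lam) = 2 powi (int (psize lam) - int (length lam)) / real (hook_product lam)"
    if "strict_partition lam" for lam
    using that by (simp add: path_weight_def psize_conv_set hook_product_conv_set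
        distinct_card[OF distinct_strict_partition])
  have W: "?W \<noteq> 0" using assms by (intro path_weight_nonzero) (auto simp: strict_partition_def)
  have content: "(\<Sum>b\<in>shifted_diagram lam. content_binom4 b) = ?g (set lam)"
    if "strict_partition lam" for lam
    using sum_content_binom4[OF that] by (simp add: content_sum_def)
  \<comment> \<open>H_mu and the power of 2 belonging to \<open>mu\<close> form 1/\<open>?W\<close>.
    The content sum of \<open>mu\<close> enters as an added constant, to which
    \<open>level_sum_const\<close> applies.\<close>
  have "(\<Sum>lam \<in> {lam. strict_partition lam \<and> contains lam mu \<and> psize lam = psize mu + n}.
            (2::real) powi (int (psize lam) - int (length lam) - int (psize mu) + int (length mu))
            * real (num_syt lam mu) * real (hook_product mu) / real (hook_product lam)
            * ((\<Sum>b\<in>shifted_diagram lam. content_binom4 b) - (\<Sum>b\<in>shifted_diagram mu. content_binom4 b)))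
      = (\<Sum>lam\<in>levels mu n. 1 / ?W * (real (num_syt lam mu) * (path_weight (set lam) * (?g (set lam) + - ?g (set mu)))))"
  proof (rule sum.cong)
    fix lam assume "lam \<in> levels mu n"
    then have lam: "strict_partition lam" by (simp add: levels_def)
    have "int (psize lam) - int (length lam) - int (psize mu) + int (length mu)
      = (int (psize lam) - int (length lam)) - (int (psize mu) - int (length mu))" by simp
    then have e: "(2::real) powi (int (psize lam) - int (length lam) - int (psize mu) + int (length mu))
      = 2 powi (int (psize lam) - int (length lam)) / 2 powi (int (psize mu) - int (length mu))"
      by (simp only:) (rule power_int_diff, simp)
    show "(2::real) powi (int (psize lam) - int (length lam) - int (psize mu) + int (length mu))
            * real (num_syt lam mu) * real (hook_product mu) / real (hook_product lam)
            * ((\<Sum>b\<in>shifted_diagram lam. content_binom4 b) - (\<Sum>b\<in>shifted_diagram mu. content_binom4 b))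
       = 1 / ?W * (real (num_syt lam mu) * (path_weight (set lam) * (?g (set lam) + - ?g (set mu))))"
      unfolding e content[OF lam] content[OF assms] pw[OF lam] pw[OF assms] by simp
  qed (simp add: levels_def)
  also have "\<dots> = 1 / ?W * level_sum mu n (\<lambda>A. ?g A + - ?g (set mu))"
    by (simp only: level_sum_def sum_distrib_left)
  also have "\<dots> = 1 / ?W * (level_sum mu n ?g + ?W * (- ?g (set mu)))"
    by (simp only: level_sum_add level_sum_const[OF assms])
  also have "\<dots> = 2/3 * real (n choose 3) + 2/3 * real (psize mu) * real (n choose 2)
     + 1/12 * ((\<Sum>a\<in>set mu. real a ^ 3) + (real (psize mu))\<^sup>2 - 2 * real (psize mu)) * real n"
    unfolding level_sum_content_sum[OF assms] using W by (simp add: field_simps)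
  also have "(\<Sum>a\<in>set mu. real a ^ 3) = real_of_int (q2 mu)"
    by (simp add: q2_conv_set[OF assms])
  finally show ?thesis .
qed

end
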